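(* Let $b:\mathbb{R}^d\times\mathcal{P}(\mathbb{R}^d)\to\mathbb{R}^d$ be a measurable function for which there is a constant $K$ such that $$|b(x,\mu)-b(x',\mu')|\le K\big(|x-x'|+\Pi_{\mathbb{R}^d}(\mu,\mu')\big),\qquad |b(x,\mu)|\le K,$$ for all $x,x'\in\mathbb{R}^d$, $\mu,\mu'\in\mathcal{P}(\mathbb{R}^d)$. Then, given $\nu\in\mathcal{P}(\mathbb{R}^d\times D_T)$, the solution map $$S^\nu:\mathbb{R}^d\times D_T\to D_T,\qquad (x_0,\gamma)\mapsto S^\nu(x_0,\gamma),$$ to the equation $$x_t=x_0+\int_0^t b(x_s,(x_s)_\#\nu)\,ds+\gamma_t,\qquad t\in[0,T],$$ is well defined; that is, there is exactly one measurable map $x=S^\nu$ from $\mathbb{R}^d\times D_T$ to $D_T$ such that $t\mapsto x_t(x_0,\gamma)$ satisfies this equation for every $(x_0,\gamma)\in\mathbb{R}^d\times D_T$.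
   Context: $T>0$ is fixed and $D_T=D([0,T],\mathbb{R}^d)$ is the space of càdlàg functions, endowed with the Skorokhod metric $\sigma(\gamma,\gamma')=\inf_{\lambda\in\Lambda}\{\|\lambda\|+\|\gamma-\gamma'\circ\lambda\|_\infty\}$, where $\Lambda$ is the set of strictly increasing bijections of $[0,T]$ and $\|\lambda\|=\sup_{s\ne t}\big|\log\frac{\lambda_t-\lambda_s}{t-s}\big|$; $(D_T,\sigma)$ is Polish and carries its Borel $\sigma$-algebra. $\mathcal{P}(E)$ denotes the Borel probability measures on $E$. $\Pi_{\mathbb{R}^d}$ is a metric on $\mathcal{P}(\mathbb{R}^d)$ that is complete, metrizes weak convergence of measures, and satisfies $\Pi_{\mathbb{R}^d}(\mathcal{L}(X),\mathcal{L}(X'))\le\mathbb{E}|X-X'|$ for any two $\mathbb{R}^d$-valued random variables $X,X'$ defined on a common probability space ($\mathcal{L}$ denotes law). In the equation, $x_s$ is regarded as the map $(x_0,\gamma)\mapsto x_s(x_0,\gamma)\in\mathbb{R}^d$ on $\mathbb{R}^d\times D_T$, and $(x_s)_\#\nu\in\mathcal{P}(\mathbb{R}^d)$ is the push-forward of $\nu$ under that map. *)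

theory Defs
  imports "HOL-Probability.Probability"
begin

section \<open>Borel probability measures on an abstract topological space\<close>

definition borel_of :: "'a topology \<Rightarrow> 'a measure" where
  "borel_of X = sigma (topspace X) {U. openin X U}"

definition borel_prob :: "'a topology \<Rightarrow> 'a measure set" where
  "borel_prob X = {\<mu>. prob_space \<mu> \<and> sets \<mu> = sets (borel_of X)}"

lemma borel_of_euclidean: "borel_of euclidean = borel"
  by (simp add: borel_of_def borel_def)

lemma space_borel_of [simp]: "space (borel_of X) = topspace X"
  unfolding borel_of_def by (rule space_measure_of) (auto dest: openin_subset)

section \<open>The Skorokhod space\<close>

text \<open>Paths on \<open>[0, T]\<close> are total functions equal to \<open>undefined\<close> off \<open>{0..T}\<close>, so that equality
  in \<open>cadlag T\<close> is equality on \<open>{0..T}\<close>.\<close>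

definition cadlag :: "real \<Rightarrow> (real \<Rightarrow> 'a::real_normed_vector) set" where
  "cadlag T = {\<gamma> \<in> extensional {0..T}.
     (\<forall>t\<in>{0..<T}. (\<gamma> \<longlongrightarrow> \<gamma> t) (at_right t)) \<and>
     (\<forall>t\<in>{0<..T}. \<exists>l. (\<gamma> \<longlongrightarrow> l) (at_left t))}"

definition time_changes :: "real \<Rightarrow> (real \<Rightarrow> real) set" where
  "time_changes T = {l. strict_mono_on {0..T} l \<and> bij_betw l {0..T} {0..T}}"

text \<open>The suprema below may be infinite, hence the type \<^typ>\<open>ennreal\<close>. The resulting
  infimum is finite on \<open>cadlag T\<close>, as the identity is a time change.\<close>

definition time_change_norm :: "real \<Rightarrow> (real \<Rightarrow> real) \<Rightarrow> ennreal" where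
  "time_change_norm T l =
     (SUP (s, t) \<in> {(s, t). s \<in> {0..T} \<and> t \<in> {0..T} \<and> s \<noteq> t}.
        ennreal \<bar>ln ((l t - l s) / (t - s))\<bar>)"

definition sup_dist :: "real \<Rightarrow> (real \<Rightarrow> 'a) \<Rightarrow> (real \<Rightarrow> 'a::real_normed_vector) \<Rightarrow> ennreal" where
  "sup_dist T f g = (SUP t\<in>{0..T}. ennreal (norm (f t - g t)))"

definition skorokhod_edist :: "real \<Rightarrow> (real \<Rightarrow> 'a) \<Rightarrow> (real \<Rightarrow> 'a::real_normed_vector) \<Rightarrow> ennreal" where
  "skorokhod_edist T f g =
     (INF l \<in> time_changes T. time_change_norm T l + sup_dist T f (g \<circ> l))"

definition skorokhod_dist :: "real \<Rightarrow> (real \<Rightarrow> 'a) \<Rightarrow> (real \<Rightarrow> 'a::real_normed_vector) \<Rightarrow> real" where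
  "skorokhod_dist T f g = enn2real (skorokhod_edist T f g)"

definition skorokhod_topology :: "real \<Rightarrow> (real \<Rightarrow> 'a::real_normed_vector) topology" where
  "skorokhod_topology T = Metric_space.mtopology (cadlag T) (skorokhod_dist T)"

lemma time_changesD:
  assumes "l \<in> time_changes T"
  shows "s \<in> {0..T} \<Longrightarrow> l s \<in> {0..T}"
    and "s \<in> {0..T} \<Longrightarrow> t \<in> {0..T} \<Longrightarrow> s < t \<Longrightarrow> l s < l t"
    and "s \<in> {0..T} \<Longrightarrow> \<exists>u\<in>{0..T}. l u = s"
proof -
  show "s \<in> {0..T} \<Longrightarrow> l s \<in> {0..T}"
    using assms by (auto simp: time_changes_def bij_betw_def)
  show "s \<in> {0..T} \<Longrightarrow> t \<in> {0..T} \<Longrightarrow> s < t \<Longrightarrow> l s < l t"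
    using assms by (auto simp: time_changes_def strict_mono_on_def)
  show "s \<in> {0..T} \<Longrightarrow> \<exists>u\<in>{0..T}. l u = s"
  proof -
    assume "s \<in> {0..T}"
    moreover have "l ` {0..T} = {0..T}" using assms by (simp add: time_changes_def bij_betw_def)
    ultimately have "s \<in> l ` {0..T}" by simp
    then show ?thesis by (rule imageE) blast
  qed
qed

lemma time_changesI:
  assumes "\<And>s. s \<in> {0..T} \<Longrightarrow> l s \<in> {0..T}"
    and "\<And>s t. s \<in> {0..T} \<Longrightarrow> t \<in> {0..T} \<Longrightarrow> s < t \<Longrightarrow> l s < l t"
    and "\<And>s. s \<in> {0..T} \<Longrightarrow> \<exists>u\<in>{0..T}. l u = s"
  shows "l \<in> time_changes T"
proof -
  have "strict_mono_on {0..T} l"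
    using assms(2) by (auto simp: strict_mono_on_def)
  moreover have "l ` {0..T} = {0..T}"
  proof (intro equalityI subsetI)
    fix y assume "y \<in> l ` {0..T}"
    then show "y \<in> {0..T}" using assms(1) by (elim imageE) simp
  next
    fix y assume "y \<in> {0..T}"
    then obtain u where "u \<in> {0..T}" "l u = y" using assms(3) by blast
    then show "y \<in> l ` {0..T}" by (metis imageI)
  qed
  ultimately show ?thesis
    by (auto simp: time_changes_def bij_betw_def intro: strict_mono_on_imp_inj_on)
qed

lemma time_change_ratio_pos:
  assumes "l \<in> time_changes T" "s \<in> {0..T}" "t \<in> {0..T}" "s \<noteq> t"
  shows "(l t - l s) / (t - s) > 0"
proof (cases "s < t")
  case True
  with time_changesD(2)[OF assms(1,2,3)] show ?thesis by simp
next
  case False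
  with assms(4) have "t < s" by simp
  with time_changesD(2)[OF assms(1,3,2)] show ?thesis by (simp add: divide_neg_neg)
qed

lemma time_change_norm_leI:
  assumes "\<And>s t. s \<in> {0..T} \<Longrightarrow> t \<in> {0..T} \<Longrightarrow> s \<noteq> t \<Longrightarrow>
    ennreal \<bar>ln ((l t - l s) / (t - s))\<bar> \<le> c"
  shows "time_change_norm T l \<le> c"
  unfolding time_change_norm_def using assms by (auto intro!: SUP_least)

lemma time_change_norm_upper:
  assumes "s \<in> {0..T}" "t \<in> {0..T}" "s \<noteq> t"
  shows "ennreal \<bar>ln ((l t - l s) / (t - s))\<bar> \<le> time_change_norm T l"
  unfolding time_change_norm_def
  using assms SUP_upper[of "(s, t)" "{(s, t). s \<in> {0..T} \<and> t \<in> {0..T} \<and> s \<noteq> t}"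
      "\<lambda>(s, t). ennreal \<bar>ln ((l t - l s) / (t - s))\<bar>"]
  by auto

lemma sup_dist_upper: "t \<in> {0..T} \<Longrightarrow> ennreal (norm (f t - g t)) \<le> sup_dist T f g"
  unfolding sup_dist_def by (rule SUP_upper)

lemma sup_dist_leI:
  "(\<And>t. t \<in> {0..T} \<Longrightarrow> ennreal (norm (f t - g t)) \<le> c) \<Longrightarrow> sup_dist T f g \<le> c"
  unfolding sup_dist_def by (rule SUP_least)

lemma time_change_id: "id \<in> time_changes T" "time_change_norm T id = 0"
proof -
  show "id \<in> time_changes T" by (rule time_changesI) auto
  have "time_change_norm T id \<le> 0" by (rule time_change_norm_leI) auto
  then show "time_change_norm T id = 0" by simp
qed

lemma skorokhod_edist_commute_le:
  "skorokhod_edist T g f \<le> skorokhod_edist T f g"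
  unfolding skorokhod_edist_def[of T f g]
proof (rule INF_greatest)
  fix l assume l: "l \<in> time_changes T"
  then have bij: "bij_betw l {0..T} {0..T}" by (simp add: time_changes_def)
  define m where "m = the_inv_into {0..T} l"
  have lm: "l (m s) = s" "m s \<in> {0..T}" if "s \<in> {0..T}" for s
    using that bij f_the_inv_into_f_bij_betw[OF bij] bij_betw_the_inv_into[OF bij]
    by (auto simp: m_def bij_betw_def)
  have ml: "m (l s) = s" if "s \<in> {0..T}" for s
    using that bij by (simp add: m_def the_inv_into_f_f bij_betw_def)
  have mono: "m s < m t" if "s \<in> {0..T}" "t \<in> {0..T}" "s < t" for s t
  proof (rule ccontr)
    assume "\<not> m s < m t"
    then have "m t = m s \<or> m t < m s" by linarith
    then show False
      using lm(1)[OF that(1)] lm(1)[OF that(2)] that(3)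
        time_changesD(2)[OF l lm(2)[OF that(2)] lm(2)[OF that(1)]] by auto
  qed
  have m: "m \<in> time_changes T"
  proof (rule time_changesI)
    fix s assume "s \<in> {0..T}"
    then show "\<exists>u\<in>{0..T}. m u = s" using ml time_changesD(1)[OF l] by blast
  qed (use lm(2) mono in auto)
  have "time_change_norm T m \<le> time_change_norm T l"
  proof (rule time_change_norm_leI)
    fix s t assume st: "s \<in> {0..T}" "t \<in> {0..T}" "s \<noteq> t"
    have ne: "m s \<noteq> m t" using lm(1) st by metis
    have "(l (m t) - l (m s)) / (m t - m s) = inverse ((m t - m s) / (t - s))"
      using lm(1) st by simp
    moreover have "(m t - m s) / (t - s) > 0" by (rule time_change_ratio_pos[OF m st])
    ultimately have "\<bar>ln ((m t - m s) / (t - s))\<bar> = \<bar>ln ((l (m t) - l (m s)) / (m t - m s))\<bar>"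
      by (simp only: ln_inverse abs_minus_cancel)
    then show "ennreal \<bar>ln ((m t - m s) / (t - s))\<bar> \<le> time_change_norm T l"
      using time_change_norm_upper[OF lm(2)[OF st(1)] lm(2)[OF st(2)] ne, of l] by simp
  qed
  moreover have "sup_dist T g (f \<circ> m) \<le> sup_dist T f (g \<circ> l)"
  proof (rule sup_dist_leI)
    fix t assume t: "t \<in> {0..T}"
    show "ennreal (norm (g t - (f \<circ> m) t)) \<le> sup_dist T f (g \<circ> l)"
      using sup_dist_upper[OF lm(2)[OF t], of f "g \<circ> l"] lm(1)[OF t]
      by (simp add: norm_minus_commute)
  qed
  ultimately have "time_change_norm T m + sup_dist T g (f \<circ> m)
      \<le> time_change_norm T l + sup_dist T f (g \<circ> l)"
    by (rule add_mono)
  then show "skorokhod_edist T g f \<le> time_change_norm T l + sup_dist T f (g \<circ> l)"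
    unfolding skorokhod_edist_def[of T g f] by (intro INF_lower2[OF m])
qed

lemma skorokhod_edist_commute: "skorokhod_edist T f g = skorokhod_edist T g f"
  by (intro antisym skorokhod_edist_commute_le)

lemma skorokhod_edist_triangle:
  "skorokhod_edist T f h \<le> skorokhod_edist T f g + skorokhod_edist T g h"
proof (rule ennreal_le_epsilon)
  fix e :: real assume e: "0 < e"
    and fin: "skorokhod_edist T f g + skorokhod_edist T g h < top"
  have "\<exists>l\<in>time_changes T. time_change_norm T l + sup_dist T f (g \<circ> l)
      < skorokhod_edist T f g + ennreal (e / 2)"
  proof -
    have "skorokhod_edist T f g < skorokhod_edist T f g + ennreal (e / 2)"
      using e fin by (simp add: less_top[symmetric])
    then show ?thesis by (subst (asm) (1) skorokhod_edist_def) (simp add: INF_less_iff)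
  qed
  then obtain l where l: "l \<in> time_changes T"
    "time_change_norm T l + sup_dist T f (g \<circ> l) < skorokhod_edist T f g + ennreal (e / 2)" by blast
  have "\<exists>m\<in>time_changes T. time_change_norm T m + sup_dist T g (h \<circ> m)
      < skorokhod_edist T g h + ennreal (e / 2)"
  proof -
    have "skorokhod_edist T g h < skorokhod_edist T g h + ennreal (e / 2)"
      using e fin by (simp add: less_top[symmetric])
    then show ?thesis by (subst (asm) (1) skorokhod_edist_def) (simp add: INF_less_iff)
  qed
  then obtain m where m: "m \<in> time_changes T"
    "time_change_norm T m + sup_dist T g (h \<circ> m) < skorokhod_edist T g h + ennreal (e / 2)" by blast
  note lD = time_changesD[OF l(1)] and mD = time_changesD[OF m(1)]
  have ml: "m \<circ> l \<in> time_changes T"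
  proof (rule time_changesI)
    fix s assume "s \<in> {0..T}"
    then show "\<exists>u\<in>{0..T}. (m \<circ> l) u = s" using lD(3) mD(3) by (metis comp_apply)
  qed (use lD(1,2) mD(1,2) in \<open>auto simp del: atLeastAtMost_iff\<close>)
  have "time_change_norm T (m \<circ> l) \<le> time_change_norm T l + time_change_norm T m"
  proof (rule time_change_norm_leI)
    fix s t assume st: "s \<in> {0..T}" "t \<in> {0..T}" "s \<noteq> t"
    have ne: "l s \<noteq> l t" using lD(2) st by (metis less_irrefl linorder_neqE)
    let ?a = "(l t - l s) / (t - s)" and ?b = "(m (l t) - m (l s)) / (l t - l s)"
    have "((m \<circ> l) t - (m \<circ> l) s) / (t - s) = ?a * ?b" using ne by simp
    moreover have "?a > 0" "?b > 0"
      using time_change_ratio_pos[OF l(1) st]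
        time_change_ratio_pos[OF m(1) lD(1)[OF st(1)] lD(1)[OF st(2)] ne] by auto
    ultimately have "\<bar>ln (((m \<circ> l) t - (m \<circ> l) s) / (t - s))\<bar> \<le> \<bar>ln ?a\<bar> + \<bar>ln ?b\<bar>"
      by (simp only: ln_mult_pos abs_triangle_ineq)
    then have "ennreal \<bar>ln (((m \<circ> l) t - (m \<circ> l) s) / (t - s))\<bar> \<le> ennreal \<bar>ln ?a\<bar> + ennreal \<bar>ln ?b\<bar>"
      by (simp add: ennreal_leI flip: ennreal_plus)
    also have "\<dots> \<le> time_change_norm T l + time_change_norm T m"
      by (intro add_mono time_change_norm_upper st lD(1) ne)
    finally show "ennreal \<bar>ln (((m \<circ> l) t - (m \<circ> l) s) / (t - s))\<bar>
        \<le> time_change_norm T l + time_change_norm T m" .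
  qed
  moreover have "sup_dist T f (h \<circ> (m \<circ> l)) \<le> sup_dist T f (g \<circ> l) + sup_dist T g (h \<circ> m)"
  proof (rule sup_dist_leI)
    fix t assume t: "t \<in> {0..T}"
    have "norm (f t - h (m (l t))) \<le> norm (f t - g (l t)) + norm (g (l t) - h (m (l t)))"
      using norm_triangle_ineq[of "f t - g (l t)" "g (l t) - h (m (l t))"] by simp
    then have "ennreal (norm (f t - h (m (l t))))
        \<le> ennreal (norm (f t - g (l t))) + ennreal (norm (g (l t) - h (m (l t))))"
      by (simp add: ennreal_leI flip: ennreal_plus)
    also have "\<dots> \<le> sup_dist T f (g \<circ> l) + sup_dist T g (h \<circ> m)"
      using sup_dist_upper[OF t, of f "g \<circ> l"] sup_dist_upper[OF lD(1)[OF t], of g "h \<circ> m"]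
      by (intro add_mono) auto
    finally show "ennreal (norm (f t - (h \<circ> (m \<circ> l)) t))
        \<le> sup_dist T f (g \<circ> l) + sup_dist T g (h \<circ> m)" by simp
  qed
  ultimately have "time_change_norm T (m \<circ> l) + sup_dist T f (h \<circ> (m \<circ> l))
      \<le> (time_change_norm T l + time_change_norm T m)
        + (sup_dist T f (g \<circ> l) + sup_dist T g (h \<circ> m))"
    by (rule add_mono)
  also have "\<dots> = (time_change_norm T l + sup_dist T f (g \<circ> l))
        + (time_change_norm T m + sup_dist T g (h \<circ> m))"
    by (simp add: ac_simps)
  also have "\<dots> \<le> (skorokhod_edist T f g + ennreal (e / 2))
        + (skorokhod_edist T g h + ennreal (e / 2))"
    by (rule add_mono[OF less_imp_le[OF l(2)] less_imp_le[OF m(2)]])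
  also have "\<dots> = (skorokhod_edist T f g + skorokhod_edist T g h)
        + (ennreal (e / 2) + ennreal (e / 2))"
    by (simp only: ac_simps)
  also have "ennreal (e / 2) + ennreal (e / 2) = ennreal e"
    using e by (simp flip: ennreal_plus)
  finally have "time_change_norm T (m \<circ> l) + sup_dist T f (h \<circ> (m \<circ> l))
      \<le> skorokhod_edist T f g + skorokhod_edist T g h + ennreal e" .
  then show "skorokhod_edist T f h \<le> skorokhod_edist T f g + skorokhod_edist T g h + ennreal e"
    unfolding skorokhod_edist_def[of T f h] by (intro INF_lower2[OF ml])
qed

lemma cadlag_bounded:
  assumes "f \<in> cadlag T"
  shows "bounded (f ` {0..T})"
proof (cases "0 \<le> T")
  case True
  define P where "P a b \<longleftrightarrow> bounded (f ` ({a..b} \<inter> {0..T}))" for a b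
  from True have "P 0 T"
  proof (rule Bolzano)
    fix a b c assume "P a b" "P b c" "a \<le> b" "b \<le> c"
    moreover from this have "f ` ({a..c} \<inter> {0..T}) \<subseteq> f ` ({a..b} \<inter> {0..T}) \<union> f ` ({b..c} \<inter> {0..T})"
      unfolding image_Un[symmetric] by (intro image_mono) auto
    ultimately show "P a c" unfolding P_def by (meson bounded_Un bounded_subset)
  next
    fix x assume x: "0 \<le> x" "x \<le> T"
    have "\<exists>d>0. \<exists>B. \<forall>y. x < y \<and> y < x + d \<and> y \<le> T \<longrightarrow> norm (f y) \<le> B"
    proof (cases "x < T")
      case True
      with assms x have "(f \<longlongrightarrow> f x) (at_right x)" by (auto simp: cadlag_def)
      then have "eventually (\<lambda>y. dist (f y) (f x) < 1) (at_right x)" by (rule tendstoD) simp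
      then obtain b where b: "b > x" "\<And>y. x < y \<Longrightarrow> y < b \<Longrightarrow> dist (f y) (f x) < 1"
        unfolding eventually_at_right_field by blast
      have "norm (f y) \<le> norm (f x) + 1" if "x < y" "y < b" for y
        using b(2)[OF that] norm_triangle_sub[of "f y" "f x"] by (simp add: dist_norm)
      with b(1) show ?thesis by (intro exI[of _ "b - x"]) auto
    next
      case False
      then show ?thesis by (intro exI[of _ 1]) auto
    qed
    then obtain d1 B1 where 1: "d1 > 0" "\<And>y. x < y \<Longrightarrow> y < x + d1 \<Longrightarrow> y \<le> T \<Longrightarrow> norm (f y) \<le> B1"
      by blast
    have "\<exists>d>0. \<exists>B. \<forall>y. y < x \<and> x - d < y \<and> 0 \<le> y \<longrightarrow> norm (f y) \<le> B"
    proof (cases "0 < x")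
      case True
      with assms x have "\<exists>l. (f \<longlongrightarrow> l) (at_left x)" by (simp add: cadlag_def)
      then obtain l where "(f \<longlongrightarrow> l) (at_left x)" by blast
      then have "eventually (\<lambda>y. dist (f y) l < 1) (at_left x)" by (rule tendstoD) simp
      then obtain b where b: "b < x" "\<And>y. b < y \<Longrightarrow> y < x \<Longrightarrow> dist (f y) l < 1"
        unfolding eventually_at_left_field by blast
      have "norm (f y) \<le> norm l + 1" if "b < y" "y < x" for y
        using b(2)[OF that] norm_triangle_sub[of "f y" l] by (simp add: dist_norm)
      with b(1) show ?thesis by (intro exI[of _ "x - b"]) auto
    next
      case False
      then show ?thesis by (intro exI[of _ 1]) auto
    qed
    then obtain d2 B2 where 2: "d2 > 0" "\<And>y. y < x \<Longrightarrow> x - d2 < y \<Longrightarrow> 0 \<le> y \<Longrightarrow> norm (f y) \<le> B2"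
      by blast
    have "P a b" if "a \<le> x" "x \<le> b" "b - a < min d1 d2" for a b
      unfolding P_def bounded_iff
    proof (intro exI ballI)
      fix v assume "v \<in> f ` ({a..b} \<inter> {0..T})"
      then obtain y where y: "v = f y" "a \<le> y" "y \<le> b" "0 \<le> y" "y \<le> T" by auto
      consider "y < x" | "y = x" | "x < y" by linarith
      then show "norm v \<le> max (norm (f x)) (max B1 B2)"
        using 1(2)[of y] 2(2)[of y] y that by cases auto
    qed
    with 1(1) 2(1) show "\<exists>d>0. \<forall>a b. a \<le> x \<and> x \<le> b \<and> b - a < d \<longrightarrow> P a b"
      by (intro exI[of _ "min d1 d2"]) auto
  qed
  then show ?thesis by (simp add: P_def)
qed auto

lemma skorokhod_edist_finite:
  assumes "f \<in> cadlag T" "g \<in> cadlag T"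
  shows "skorokhod_edist T f g < top"
proof -
  obtain A where A: "\<And>t. t \<in> {0..T} \<Longrightarrow> norm (f t) \<le> A"
    using cadlag_bounded[OF assms(1)] unfolding bounded_iff by blast
  obtain B where B: "\<And>t. t \<in> {0..T} \<Longrightarrow> norm (g t) \<le> B"
    using cadlag_bounded[OF assms(2)] unfolding bounded_iff by blast
  have "sup_dist T f (g \<circ> id) \<le> ennreal (A + B)"
  proof (rule sup_dist_leI, rule ennreal_leI)
    fix t assume t: "t \<in> {0..T}"
    show "norm (f t - (g \<circ> id) t) \<le> A + B"
      using norm_triangle_ineq4[of "f t" "g t"] A[OF t] B[OF t] by simp
  qed
  moreover have "skorokhod_edist T f g \<le> time_change_norm T id + sup_dist T f (g \<circ> id)"
    unfolding skorokhod_edist_def by (rule INF_lower) (rule time_change_id)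
  ultimately show ?thesis
    by (metis add_0 ennreal_less_top order.trans order_le_less_trans time_change_id(2))
qed

lemma skorokhod_edist_zero_imp_eq:
  assumes f: "f \<in> cadlag T" and g: "g \<in> cadlag T" and 0: "skorokhod_edist T f g = 0"
  shows "f = g"
proof (rule extensionalityI[where A = "{0..T}"])
  show "f \<in> extensional {0..T}" "g \<in> extensional {0..T}"
    using f g by (auto simp: cadlag_def)
  have ex: "\<exists>l\<in>time_changes T. time_change_norm T l < ennreal e \<and> sup_dist T f (g \<circ> l) < ennreal e"
    if "e > 0" for e
  proof -
    have "(INF l \<in> time_changes T. time_change_norm T l + sup_dist T f (g \<circ> l)) < ennreal e"
      using 0 that by (simp add: skorokhod_edist_def)
    then obtain l where l: "l \<in> time_changes T"
      "time_change_norm T l + sup_dist T f (g \<circ> l) < ennreal e"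
      unfolding INF_less_iff by blast
    have "time_change_norm T l \<le> time_change_norm T l + sup_dist T f (g \<circ> l)"
      "sup_dist T f (g \<circ> l) \<le> time_change_norm T l + sup_dist T f (g \<circ> l)" by simp_all
    with l show ?thesis by (meson order_le_less_trans)
  qed
  fix t assume t: "t \<in> {0..T}"
  show "f t = g t"
  proof (cases "t < T")
    case False
    then have tT: "t = T" "0 \<le> T" using t by auto
    have end_fixed: "l T = T" if l: "l \<in> time_changes T" for l
    proof (rule ccontr)
      assume ne: "l T \<noteq> T"
      obtain u where u: "u \<in> {0..T}" "l u = T" using time_changesD(3)[OF l, of T] tT by auto
      with ne have "u < T" by (cases "u = T") auto
      then show False
        using time_changesD(2)[OF l u(1), of T] time_changesD(1)[OF l, of T] u tT by auto
    qed
    have "norm (f t - g t) \<le> e" if e: "e > 0" for e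
    proof -
      obtain l where l: "l \<in> time_changes T" "sup_dist T f (g \<circ> l) < ennreal e"
        using ex[OF e] by blast
      have "ennreal (norm (f t - g t)) < ennreal e"
        using sup_dist_upper[OF t, of f "g \<circ> l"] end_fixed[OF l(1)] l(2) tT by simp
      then show ?thesis using e by (simp add: ennreal_less_iff)
    qed
    then have "norm (f t - g t) \<le> 0" by (rule field_le_epsilon) simp
    then show ?thesis by simp
  next
    case True
    have "norm (f t - g t) \<le> e" if e: "e > 0" for e
    proof -
      have e3: "e / 3 > 0" using e by simp
      have "(f \<longlongrightarrow> f t) (at_right t)" "(g \<longlongrightarrow> g t) (at_right t)"
        using f g t True by (auto simp: cadlag_def)
      from this[THEN tendstoD, OF e3] obtain b c where
        b: "b > t" "\<And>y. t < y \<Longrightarrow> y < b \<Longrightarrow> dist (f y) (f t) < e / 3" and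
        c: "c > t" "\<And>y. t < y \<Longrightarrow> y < c \<Longrightarrow> dist (g y) (g t) < e / 3"
        unfolding eventually_at_right_field by blast
      define d where "d = min T (min b c) - t"
      have d: "d > 0" using True b(1) c(1) by (simp add: d_def)
      define s where "s = t + d / 2"
      have td: "t + d \<le> T" "t + d \<le> b" "t + d \<le> c" by (simp_all add: d_def)
      have s: "t < s" "s < b" "s < c" "s \<in> {0..T}" "s > 0"
        using d t td by (auto simp: s_def)
      have sd: "s + d / 2 \<le> c" using td by (simp add: s_def)
      define h where "h = min (e / 3) (min (ln (1 + d / (2 * s))) (- ln (1 - min (d / (2 * s)) (1 / 2))))"
      have "d / (2 * s) > 0" using d s by simp
      then have "h > 0"
        using e by (simp add: h_def ln_gt_zero)
      then obtain l where l: "l \<in> time_changes T" "time_change_norm T l < ennreal h"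
        "sup_dist T f (g \<circ> l) < ennreal h"
        using ex by blast
      have l0: "l 0 = 0"
      proof (rule ccontr)
        assume ne: "l 0 \<noteq> 0"
        have z: "0 \<in> {0..T}" using s by auto
        obtain u where u: "u \<in> {0..T}" "l u = 0" using time_changesD(3)[OF l(1) z] by auto
        with ne have "0 < u" by (cases "u = 0") auto
        then show False
          using time_changesD(2)[OF l(1) z u(1)] time_changesD(1)[OF l(1) z] u by auto
      qed
      have z: "0 \<in> {0..T}" "0 \<noteq> s" using s by auto
      define r where "r = l s / s"
      have r: "r > 0" using time_change_ratio_pos[OF l(1) z(1) s(4) z(2)] l0 by (simp add: r_def)
      have "ennreal \<bar>ln r\<bar> < ennreal h"
        using time_change_norm_upper[OF z(1) s(4) z(2), of l] l(2) l0 by (simp add: r_def)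
      then have lnr: "\<bar>ln r\<bar> < h" by (simp add: ennreal_less_iff)
      have "ln r < ln (1 + d / (2 * s))" using lnr by (auto simp: h_def)
      then have r1: "r < 1 + d / (2 * s)" using r d s by (subst (asm) ln_less_cancel_iff) (auto intro: add_pos_pos)
      have "ln r > ln (1 - min (d / (2 * s)) (1 / 2))" using lnr by (auto simp: h_def)
      then have "r > 1 - min (d / (2 * s)) (1 / 2)" using r by (subst (asm) ln_less_cancel_iff) auto
      then have r2: "r > 1 - d / (2 * s)" by auto
      have ls: "l s = r * s" using s by (simp add: r_def)
      have "l s < (1 + d / (2 * s)) * s" "l s > (1 - d / (2 * s)) * s"
        unfolding ls using r1 r2 s by (auto intro: mult_strict_right_mono)
      moreover have "(1 + d / (2 * s)) * s = s + d / 2" "(1 - d / (2 * s)) * s = s - d / 2"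
        using s by (simp_all add: distrib_right left_diff_distrib)
      ultimately have "l s < s + d / 2" "l s > s - d / 2" by simp_all
      then have lsI: "t < l s" "l s < c" using sd by (auto simp: s_def)
      have "ennreal (norm (f s - g (l s))) < ennreal h"
        using sup_dist_upper[OF s(4), of f "g \<circ> l"] l(3) by simp
      then have "norm (f s - g (l s)) < e / 3" by (simp add: ennreal_less_iff h_def)
      then have "dist (f s) (g (l s)) < e / 3" by (simp add: dist_norm)
      with b(2)[OF s(1,2)] c(2)[OF lsI] have "dist (f t) (g t) < e"
        using dist_triangle[of "f t" "g t" "f s"] dist_triangle[of "f s" "g t" "g (l s)"]
        by (simp add: dist_commute)
      then show ?thesis by (simp add: dist_norm)
    qed
    then have "norm (f t - g t) \<le> 0" by (rule field_le_epsilon) simp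
    then show ?thesis by simp
  qed
qed

lemma Metric_space_skorokhod: "Metric_space (cadlag T) (skorokhod_dist T)"
proof
  fix f g h :: "real \<Rightarrow> 'a"
  show "0 \<le> skorokhod_dist T f g" by (simp add: skorokhod_dist_def)
  show "skorokhod_dist T f g = skorokhod_dist T g f"
    by (simp add: skorokhod_dist_def skorokhod_edist_commute)
  assume fg: "f \<in> cadlag T" "g \<in> cadlag T"
  have "skorokhod_edist T f f = 0"
  proof -
    have "skorokhod_edist T f f \<le> time_change_norm T id + sup_dist T f (f \<circ> id)"
      unfolding skorokhod_edist_def by (rule INF_lower) (rule time_change_id)
    moreover have "sup_dist T f (f \<circ> id) \<le> 0" by (rule sup_dist_leI) simp
    ultimately show ?thesis by (simp add: time_change_id)
  qed
  then show "skorokhod_dist T f g = 0 \<longleftrightarrow> f = g"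
    using skorokhod_edist_finite[OF fg] skorokhod_edist_zero_imp_eq[OF fg]
    by (auto simp: skorokhod_dist_def enn2real_eq_0_iff)
  assume h: "h \<in> cadlag T"
  have "enn2real (skorokhod_edist T f h) \<le> enn2real (skorokhod_edist T f g + skorokhod_edist T g h)"
    using skorokhod_edist_finite[OF fg] skorokhod_edist_finite[OF fg(2) h]
    by (intro enn2real_mono skorokhod_edist_triangle) simp
  also have "\<dots> = enn2real (skorokhod_edist T f g) + enn2real (skorokhod_edist T g h)"
    using skorokhod_edist_finite[OF fg] skorokhod_edist_finite[OF fg(2) h] by (rule enn2real_plus)
  finally show "skorokhod_dist T f h \<le> skorokhod_dist T f g + skorokhod_dist T g h"
    by (simp add: skorokhod_dist_def)
qed

lemma topspace_skorokhod [simp]: "topspace (skorokhod_topology T) = cadlag T"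
  unfolding skorokhod_topology_def
  by (rule Metric_space.topspace_mtopology[OF Metric_space_skorokhod])

section \<open>Metrics on the space of Borel probability measures\<close>

definition metrizes_weak_convergence ::
    "('a::euclidean_space measure \<Rightarrow> 'a measure \<Rightarrow> real) \<Rightarrow> bool" where
  "metrizes_weak_convergence d \<longleftrightarrow>
     (\<forall>M \<mu>. range M \<subseteq> borel_prob euclidean \<longrightarrow> \<mu> \<in> borel_prob euclidean \<longrightarrow>
        limitin (Metric_space.mtopology (borel_prob euclidean) d) M \<mu> sequentially \<longleftrightarrow>
        (\<forall>\<phi>::'a \<Rightarrow> real. continuous_on UNIV \<phi> \<longrightarrow> bounded (range \<phi>) \<longrightarrow>
           (\<lambda>n. \<integral>x. \<phi> x \<partial>M n) \<longlonglongrightarrow> (\<integral>x. \<phi> x \<partial>\<mu>)))"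

text \<open>A formula cannot quantify over the type of the underlying probability space, so this type
  is fixed to \<^typ>\<open>'a \<times> 'a\<close>. That is no restriction: the bound then holds for random variables
  on an arbitrary probability space, as the lemma below shows.\<close>

definition dominated_by_expectation ::
    "('a::euclidean_space measure \<Rightarrow> 'a measure \<Rightarrow> real) \<Rightarrow> bool" where
  "dominated_by_expectation d \<longleftrightarrow>
     (\<forall>(M :: ('a \<times> 'a) measure) X X'.
        prob_space M \<longrightarrow> X \<in> borel_measurable M \<longrightarrow> X' \<in> borel_measurable M \<longrightarrow>
        ennreal (d (distr M borel X) (distr M borel X')) \<le> (\<integral>\<^sup>+\<omega>. ennreal (norm (X \<omega> - X' \<omega>)) \<partial>M))"

lemma dominated_by_expectationD:
  fixes M :: "'b measure" and X X' :: "'b \<Rightarrow> 'a::euclidean_space"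
  assumes d: "dominated_by_expectation d" and M: "prob_space M"
    and [measurable]: "X \<in> borel_measurable M" "X' \<in> borel_measurable M"
  shows "ennreal (d (distr M borel X) (distr M borel X')) \<le> (\<integral>\<^sup>+\<omega>. ennreal (norm (X \<omega> - X' \<omega>)) \<partial>M)"
proof -
  let ?N = "distr M (borel \<Otimes>\<^sub>M borel) (\<lambda>\<omega>. (X \<omega>, X' \<omega>))"
  have "prob_space ?N" by (intro prob_space.prob_space_distr M) measurable
  then have "ennreal (d (distr ?N borel fst) (distr ?N borel snd))
      \<le> (\<integral>\<^sup>+\<omega>. ennreal (norm (fst \<omega> - snd \<omega>)) \<partial>?N)"
    using d unfolding dominated_by_expectation_def by auto
  then show ?thesis
    by (simp add: distr_distr nn_integral_distr o_def)
qed

section \<open>The equation\<close>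

text \<open>\<open>mv_drift b \<nu> S s y\<close> is the drift \<open>b(y, (x\<^sub>s)\<^sub>#\<nu>)\<close>, the time marginal being that of the
  map \<open>S\<close>, for which \<open>S (x\<^sub>0, \<gamma>) s\<close> plays the role of \<open>x\<^sub>s(x\<^sub>0, \<gamma>)\<close>.\<close>

definition mv_drift ::
    "('a::euclidean_space \<Rightarrow> 'a measure \<Rightarrow> 'a) \<Rightarrow> ('a \<times> (real \<Rightarrow> 'a)) measure \<Rightarrow>
     ('a \<times> (real \<Rightarrow> 'a) \<Rightarrow> real \<Rightarrow> 'a) \<Rightarrow> real \<Rightarrow> 'a \<Rightarrow> 'a" where
  "mv_drift b \<nu> S s y = b y (distr \<nu> borel (\<lambda>p. S p s))"

text \<open>Integrability is demanded explicitly, since the Bochner integral of a non-integrable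
  function is \<open>0\<close> by convention.\<close>

definition solves_mv_equation ::
    "real \<Rightarrow> ('a::euclidean_space \<Rightarrow> 'a measure \<Rightarrow> 'a) \<Rightarrow> ('a \<times> (real \<Rightarrow> 'a)) measure \<Rightarrow>
     ('a \<times> (real \<Rightarrow> 'a) \<Rightarrow> real \<Rightarrow> 'a) \<Rightarrow> bool" where
  "solves_mv_equation T b \<nu> S \<longleftrightarrow>
     (\<forall>x0. \<forall>\<gamma>\<in>cadlag T. \<forall>t\<in>{0..T}.
        set_integrable lborel {0..t} (\<lambda>s. mv_drift b \<nu> S s (S (x0, \<gamma>) s)) \<and>
        S (x0, \<gamma>) t = x0 + (LINT s:{0..t}|lborel. mv_drift b \<nu> S s (S (x0, \<gamma>) s)) + \<gamma> t)"

abbreviation path_input_topology ::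
    "real \<Rightarrow> ('a::euclidean_space \<times> (real \<Rightarrow> 'a)) topology" where
  "path_input_topology T \<equiv> prod_topology euclidean (skorokhod_topology T)"

end

theory Submission
  imports Defs
begin

text \<open>Write \<open>x = x\<^sub>0 + \<gamma> + v\<close>. The equation becomes a fixed point problem for \<open>v\<close>, the drift term. If
  two candidates differ by at most \<open>C (2Ks)\<^sup>k / k!\<close> at time \<open>s\<close>, uniformly over all inputs, then so do
  the expectations of their differences, hence the distances of their laws, and their images differ
  by at most \<open>C (2Kt)\<^sup>k\<^sup>+\<^sup>1 / (k+1)!\<close> at time \<open>t\<close>. This gives uniqueness at once and uniform convergence
  of the Picard iteration. Measurability comes from continuity: Skorokhod convergence
  implies pointwise convergence at continuity points of the limit, that is, at all but countably
  many times, so by dominated convergence every iterate, and with it \<open>v\<close>, depends continuously on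
  \<open>(x\<^sub>0, \<gamma>)\<close>, uniformly in time. Adding a uniformly convergent sequence with continuous limit
  preserves Skorokhod convergence, so the solution map is even continuous.\<close>

section \<open>Right-continuous functions\<close>

text \<open>Every \<open>t\<close> has an interval to its right on which \<open>f\<close> varies by
  less than \<open>e\<close>, and no point of that interval lies in \<open>J e\<close>. The
  intervals attached to the points of \<open>J e\<close> are thus pairwise disjoint and open, so
  there are only countably many.\<close>

lemma countable_discont_right_continuous:
  fixes f :: "real \<Rightarrow> 'a::metric_space"
  assumes right: "\<And>t. (f \<longlongrightarrow> f t) (at_right t)"
  shows "countable {t. \<not> isCont f t}"
proof -
  \<comment> \<open>\<open>J e\<close> holds the points without a neighbourhood on which all values
    of \<open>f\<close> lie within \<open>e\<close> of each other; a discontinuity belongs to it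
    once \<open>e > 0\<close> is small enough.\<close>
  define J where "J e = {t. \<not> (\<exists>d>0. \<forall>x y. dist t x < d \<longrightarrow> dist t y < d \<longrightarrow> dist (f x) (f y) < e)}" for e
  have J_countable: "countable (J e)" if "e > 0" for e
  proof -
    have "\<exists>u>t. \<forall>x y. t < x \<longrightarrow> x < u \<longrightarrow> t < y \<longrightarrow> y < u \<longrightarrow> dist (f x) (f y) < e" for t
    proof -
      have "eventually (\<lambda>x. dist (f x) (f t) < e / 2) (at_right t)"
        using right[of t] \<open>e > 0\<close> by (intro tendstoD) auto
      then obtain u where u: "u > t" "\<And>x. t < x \<Longrightarrow> x < u \<Longrightarrow> dist (f x) (f t) < e / 2"
        unfolding eventually_at_right_field by blast
      then show ?thesis by (meson dist_triangle_half_r dist_commute dist_triangle_half_l)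
    qed
    then obtain u where u: "\<And>t. u t > t"
      "\<And>t x y. t < x \<Longrightarrow> x < u t \<Longrightarrow> t < y \<Longrightarrow> y < u t \<Longrightarrow> dist (f x) (f y) < e"
      by metis
    have avoid: "s \<notin> J e" if "t < s" "s < u t" for s t
    proof -
      have "dist (f x) (f y) < e"
        if "dist s x < min (s - t) (u t - s)" "dist s y < min (s - t) (u t - s)" for x y
        using that by (intro u(2)[of t]) (auto simp: dist_real_def)
      moreover have "min (s - t) (u t - s) > 0" using that by simp
      ultimately show ?thesis unfolding J_def by blast
    qed
    have disj: "u s \<le> t" if "s \<in> J e" "t \<in> J e" "s < t" for s t
      using avoid[of s t] that by force
    define I where "I t = {t<..<u t}" for t
    have "pairwise disjnt (I ` J e)"
    proof (rule pairwiseI)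
      fix A B assume AB: "A \<in> I ` J e" "B \<in> I ` J e" "A \<noteq> B"
      then obtain s t where "s \<in> J e" "t \<in> J e" "A = I s" "B = I t" "s \<noteq> t" by blast
      then show "disjnt A B"
        using disj[of s t] disj[of t s] by (cases "s < t") (auto simp: I_def disjnt_iff)
    qed
    then have "countable (I ` J e)"
      by (intro countable_disjoint_open_subsets) (auto simp: I_def)
    \<comment> \<open>The left end point recovers \<open>t\<close> from \<open>I t\<close>, so
      counting intervals counts points.\<close>
    moreover have "inj_on I (J e)"
    proof (rule inj_onI)
      fix s t assume "I s = I t"
      then have "Inf (I s) = Inf (I t)" by simp
      then show "s = t" using u(1) by (simp add: I_def)
    qed
    ultimately show ?thesis by (rule countable_image_inj_on)
  qed
  have "{t. \<not> isCont f t} \<subseteq> (\<Union>n. J (inverse (real (Suc n))))"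
  proof
    fix t assume "t \<in> {t. \<not> isCont f t}"
    then obtain e where e: "e > 0" "\<And>d. d > 0 \<Longrightarrow> \<exists>x. dist x t < d \<and> \<not> dist (f x) (f t) < e"
      unfolding continuous_at_eps_delta by (auto simp: dist_norm)
    obtain n where n: "inverse (real (Suc n)) < e" using reals_Archimedean[OF e(1)] by blast
    have "t \<in> J (inverse (real (Suc n)))"
      unfolding J_def
    proof (intro CollectI notI)
      assume "\<exists>d>0. \<forall>x y. dist t x < d \<longrightarrow> dist t y < d \<longrightarrow> dist (f x) (f y) < inverse (real (Suc n))"
      then obtain d where "d > 0"
        "\<And>x. dist t x < d \<Longrightarrow> dist (f x) (f t) < inverse (real (Suc n))" by auto
      with e(2)[of d] n show False by (metis dist_commute less_trans)
    qed
    then show "t \<in> (\<Union>n. J (inverse (real (Suc n))))" by blast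
  qed
  moreover have "countable (\<Union>n. J (inverse (real (Suc n))))"
    by (intro countable_UN J_countable) auto
  ultimately show ?thesis by (rule countable_subset)
qed

lemma borel_measurable_right_continuous:
  fixes f :: "real \<Rightarrow> 'a::metric_space"
  assumes "\<And>t. (f \<longlongrightarrow> f t) (at_right t)"
  shows "f \<in> borel_measurable borel"
proof (rule borel_measurable_continuous_countable_exceptions)
  show "countable {t. \<not> isCont f t}" by (rule countable_discont_right_continuous) fact
  show "continuous_on (- {t. \<not> isCont f t}) f"
    by (rule continuous_at_imp_continuous_on) simp
qed

lemma AE_isCont_right_continuous:
  fixes f :: "real \<Rightarrow> 'a::metric_space"
  assumes "\<And>t. (f \<longlongrightarrow> f t) (at_right t)"
  shows "AE t in lborel. isCont f t"
  by (rule AE_I'[of "{t. \<not> isCont f t}"])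
    (use countable_imp_null_set_lborel[OF countable_discont_right_continuous[OF assms]] in auto)

section \<open>Continuous and Borel maps between topologies\<close>

lemma measurable_borel_ofI:
  assumes "f \<in> topspace X \<rightarrow> topspace Y"
    and "\<And>U. openin Y U \<Longrightarrow> {x \<in> topspace X. f x \<in> U} \<in> sets (borel_of X)"
  shows "f \<in> borel_of X \<rightarrow>\<^sub>M borel_of Y"
  unfolding borel_of_def[of Y]
proof (rule measurable_measure_of)
  fix U assume "U \<in> {U. openin Y U}"
  then show "f -` U \<inter> space (borel_of X) \<in> sets (borel_of X)"
    using assms(2)[of U] by (simp add: vimage_def Int_def conj_commute)
qed (use assms(1) openin_subset in auto)

lemma openin_in_sets_borel_of: "openin X U \<Longrightarrow> U \<in> sets (borel_of X)"
  unfolding borel_of_def by (subst sets_measure_of) (auto dest: openin_subset)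

lemma continuous_map_measurable_borel_of:
  assumes "continuous_map X Y f"
  shows "f \<in> borel_of X \<rightarrow>\<^sub>M borel_of Y"
  using assms by (intro measurable_borel_ofI openin_in_sets_borel_of)
    (auto simp: continuous_map_def)

text \<open>Closedness in a metrizable domain can be tested on sequences, and a closed set contains
  the limits of its sequences. Hence preimages of closed sets are closed, and only the domain has to
  be metrizable.\<close>

lemma continuous_map_sequentiallyI:
  assumes X: "metrizable_space X" and f: "f \<in> topspace X \<rightarrow> topspace Y"
    and lim: "\<And>\<sigma> l. range \<sigma> \<subseteq> topspace X \<Longrightarrow> limitin X \<sigma> l sequentially \<Longrightarrow>
      limitin Y (\<lambda>n. f (\<sigma> n)) (f l) sequentially"
  shows "continuous_map X Y f"
  unfolding continuous_map_closedin
proof (intro conjI allI impI)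
  show "f \<in> topspace X \<rightarrow> topspace Y" by (rule f)
  fix C assume C: "closedin Y C"
  obtain M d where M: "Metric_space M d" and X_eq: "X = Metric_space.mtopology M d"
    using X by (auto simp: metrizable_space_def)
  have top: "topspace X = M" using Metric_space.topspace_mtopology[OF M] X_eq by simp
  show "closedin X {x \<in> topspace X. f x \<in> C}"
    unfolding X_eq Metric_space.metric_closedin_iff_sequentially_closed[OF M]
  proof (intro conjI allI impI)
    show "{x \<in> topspace (Metric_space.mtopology M d). f x \<in> C} \<subseteq> M"
      using top X_eq by auto
    fix \<sigma> l
    assume "range \<sigma> \<subseteq> {x \<in> topspace (Metric_space.mtopology M d). f x \<in> C} \<and>
      limitin (Metric_space.mtopology M d) \<sigma> l sequentially"
    then have \<sigma>: "range \<sigma> \<subseteq> {x \<in> topspace X. f x \<in> C}" "limitin X \<sigma> l sequentially"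
      using X_eq by auto
    have "f l \<in> C"
    proof (rule limitin_closedin[OF lim C])
      show "range \<sigma> \<subseteq> topspace X" "limitin X \<sigma> l sequentially" using \<sigma> by auto
      show "\<forall>\<^sub>F n in sequentially. f (\<sigma> n) \<in> C" using \<sigma> by (intro always_eventually) auto
    qed simp
    then show "l \<in> {x \<in> topspace (Metric_space.mtopology M d). f x \<in> C}"
      using \<sigma>(2) X_eq limitin_topspace by fastforce
  qed
qed

section \<open>The Skorokhod topology\<close>

text \<open>Freezing a path outside \<open>[0, T]\<close> makes it right-continuous on the whole line, so that the
  end points need no separate treatment.\<close>

definition stop :: "real \<Rightarrow> real \<Rightarrow> real" where
  "stop T s = max 0 (min T s)"

lemma stop_in [simp]: "T > 0 \<Longrightarrow> stop T s \<in> {0..T}"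
  and stop_bounds [simp]: "0 \<le> stop T s" "T > 0 \<Longrightarrow> stop T s \<le> T"
  and stop_id: "s \<in> {0..T} \<Longrightarrow> stop T s = s"
  by (auto simp: stop_def max_def min_def)

lemma right_continuous_stopped:
  assumes \<gamma>: "\<gamma> \<in> cadlag T" and T: "T > 0"
  shows "((\<lambda>s. \<gamma> (stop T s)) \<longlongrightarrow> \<gamma> (stop T t)) (at_right t)"
proof -
  consider "t < 0" | "t \<in> {0..<T}" | "t \<ge> T" by force
  then show ?thesis
  proof cases
    case 1
    have "eventually (\<lambda>s. \<gamma> (stop T t) = \<gamma> (stop T s)) (at_right t)"
      using 1 T unfolding eventually_at_right_field by (intro exI[of _ 0]) (auto simp: stop_def)
    then show ?thesis by (rule tendsto_eventually[OF eventually_mono]) auto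
  next
    case 2
    have "eventually (\<lambda>s. \<gamma> s = \<gamma> (stop T s)) (at_right t)"
      using 2 T unfolding eventually_at_right_field by (intro exI[of _ T]) (auto simp: stop_def)
    moreover have "(\<gamma> \<longlongrightarrow> \<gamma> (stop T t)) (at_right t)"
      using \<gamma> 2 by (auto simp: cadlag_def stop_id)
    ultimately show ?thesis by (rule Lim_transform_eventually[rotated])
  next
    case 3
    have "eventually (\<lambda>s. \<gamma> (stop T t) = \<gamma> (stop T s)) (at_right t)"
      using 3 T unfolding eventually_at_right_field by (intro exI[of _ "t + 1"]) (auto simp: stop_def)
    then show ?thesis by (rule tendsto_eventually[OF eventually_mono]) auto
  qed
qed

section \<open>Time changes close to the identity\<close>

lemma time_change_zero:
  assumes l: "l \<in> time_changes T" and T: "T \<ge> 0"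
  shows "l 0 = 0"
proof -
  have z: "0 \<in> {0..T}" using T by simp
  obtain u where u: "u \<in> {0..T}" "l u = 0" using time_changesD(3)[OF l z] by auto
  show ?thesis
    using time_changesD(2)[OF l z u(1)] time_changesD(1)[OF l z] u by (cases "u = 0") auto
qed

lemma time_change_end:
  assumes l: "l \<in> time_changes T" and T: "T \<ge> 0"
  shows "l T = T"
proof -
  have z: "T \<in> {0..T}" using T by simp
  obtain u where u: "u \<in> {0..T}" "l u = T" using time_changesD(3)[OF l z] by auto
  show ?thesis
    using time_changesD(2)[OF l u(1) z] time_changesD(1)[OF l z] u by (cases "u = T") auto
qed

text \<open>Since \<open>l\<close> fixes 0, the chord from 0 to \<open>t\<close> has slope
  \<open>l t / t\<close>. The norm of \<open>l\<close> bounds the logarithm of this slope, so the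
  slope lies between \<open>exp (- e)\<close> and \<open>exp e\<close>; multiplying its distance
  from 1 by \<open>t\<close> gives the displacement.\<close>

lemma time_change_displacement:
  assumes l: "l \<in> time_changes T" and e: "e > 0" "time_change_norm T l \<le> ennreal e"
    and t: "t \<in> {0..T}"
  shows "\<bar>l t - t\<bar> \<le> T * (exp e - 1)"
proof (cases "t = 0")
  case True
  then show ?thesis using time_change_zero[OF l] t e by simp
next
  case False
  with t have t0: "t > 0" and z: "0 \<in> {0..T}" by auto
  have l0: "l 0 = 0" using time_change_zero[OF l] t by simp
  have r: "l t / t > 0" using time_change_ratio_pos[OF l z t] t0 l0 by simp
  have "ennreal \<bar>ln (l t / t)\<bar> \<le> ennreal e"
    using time_change_norm_upper[OF z t, of l] e(2) t0 l0 by (auto intro: order_trans)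
  then have "\<bar>ln (l t / t)\<bar> \<le> e" using e(1) by (simp add: ennreal_le_iff)
  then have "exp (- e) \<le> exp (ln (l t / t))" "exp (ln (l t / t)) \<le> exp e" by auto
  then have b: "exp (- e) \<le> l t / t" "l t / t \<le> exp e" using r by simp_all
  have "exp e * exp (- e) = 1" by (simp flip: exp_add)
  \<comment> \<open>Expanding this product gives \<open>exp e + exp (- e) - 2\<close>, so the lower
    deviation of the slope from 1 never exceeds the upper one.\<close>
  moreover have "0 \<le> (exp e - 1) * (1 - exp (- e))" using e(1) by (intro mult_nonneg_nonneg) auto
  ultimately have "1 - exp (- e) \<le> exp e - 1" by (simp add: algebra_simps)
  with b have "\<bar>l t / t - 1\<bar> \<le> exp e - 1" by linarith
  then have "\<bar>l t / t - 1\<bar> * t \<le> (exp e - 1) * T"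
    using t e(1) t0 by (intro mult_mono) auto
  moreover have "\<bar>l t / t - 1\<bar> * t = \<bar>(l t / t - 1) * t\<bar>" using t0 by (simp add: abs_mult)
  moreover have "(l t / t - 1) * t = l t - t" using t0 by (simp add: field_simps)
  ultimately show ?thesis by (simp add: mult.commute)
qed

text \<open>The infimum need not be attained, but the strict inequality leaves room for a time
  change whose total cost is below \<open>e\<close>; each of the two summands is then at most
  \<open>e\<close>.\<close>

lemma skorokhod_dist_less_time_change:
  assumes "f \<in> cadlag T" "g \<in> cadlag T" and d: "skorokhod_dist T f g < e"
  obtains l where "l \<in> time_changes T" "time_change_norm T l \<le> ennreal e"
    "\<And>t. t \<in> {0..T} \<Longrightarrow> \<bar>l t - t\<bar> \<le> T * (exp e - 1)"
    "\<And>t. t \<in> {0..T} \<Longrightarrow> norm (f t - g (l t)) \<le> e"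
proof -
  have e: "e > 0" using d unfolding skorokhod_dist_def by (rule order_le_less_trans[rotated]) simp
  have "ennreal (skorokhod_dist T f g) = skorokhod_edist T f g"
    using skorokhod_edist_finite[OF assms(1,2)] by (simp add: skorokhod_dist_def)
  then have "skorokhod_edist T f g < ennreal e"
    using d e by (metis ennreal_lessI)
  then obtain l where l: "l \<in> time_changes T"
    "time_change_norm T l + sup_dist T f (g \<circ> l) < ennreal e"
    unfolding skorokhod_edist_def INF_less_iff by blast
  have n: "time_change_norm T l \<le> ennreal e"
    using l(2) by (metis le_iff_add less_imp_le order_trans)
  have "sup_dist T f (g \<circ> l) \<le> ennreal e"
    using l(2) by (metis add.commute le_iff_add less_imp_le order_trans)
  then have "ennreal (norm (f t - (g \<circ> l) t)) \<le> ennreal e" if "t \<in> {0..T}" for t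
    using sup_dist_upper[OF that, of f "g \<circ> l"] by (rule order_trans[rotated])
  then have "norm (f t - g (l t)) \<le> e" if "t \<in> {0..T}" for t
    using that e by (simp add: ennreal_le_iff)
  then show thesis using that[OF l(1) n time_change_displacement[OF l(1) e n]] by blast
qed

lemma skorokhod_dist_leI:
  assumes "l \<in> time_changes T" "time_change_norm T l \<le> ennreal a"
    "\<And>t. t \<in> {0..T} \<Longrightarrow> norm (f t - g (l t)) \<le> c" "0 \<le> a" "0 \<le> c"
  shows "skorokhod_dist T f g \<le> a + c"
proof -
  have "sup_dist T f (g \<circ> l) \<le> ennreal c"
    by (rule sup_dist_leI) (auto intro!: ennreal_leI assms(3))
  with assms(2) have "time_change_norm T l + sup_dist T f (g \<circ> l) \<le> ennreal a + ennreal c"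
    by (rule add_mono)
  then have "skorokhod_edist T f g \<le> ennreal (a + c)"
    unfolding skorokhod_edist_def using assms(1,4,5)
    by (intro INF_lower2[OF assms(1)]) (simp flip: ennreal_plus)
  then show ?thesis
    unfolding skorokhod_dist_def using assms(4,5) by (intro enn2real_leI) auto
qed

section \<open>Evaluation of paths at a fixed time\<close>

lemma exp_displacement_small:
  assumes "d > 0" "T > (0::real)"
  obtains e where "e > 0" "T * (exp e - 1) < d"
proof -
  have "((\<lambda>e. T * (exp e - 1)) \<longlongrightarrow> T * (exp 0 - 1)) (at_right (0::real))"
    by (intro tendsto_intros)
  then have "eventually (\<lambda>e. T * (exp e - 1) < d) (at_right (0::real))"
    using assms by (intro order_tendstoD(2)) auto
  then have "eventually (\<lambda>e. e > 0 \<and> T * (exp e - 1) < d) (at_right (0::real))"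
    by (rule eventually_conj[OF eventually_at_right_less])
  then have "\<exists>e. e > 0 \<and> T * (exp e - 1) < d"
    by (rule eventually_happens'[OF trivial_limit_at_right_real])
  then show thesis using that by blast
qed

text \<open>For large \<open>n\<close> the value \<open>\<gamma> n t\<close> is close to
  \<open>g (l t)\<close> for a time change \<open>l\<close> that barely moves \<open>t\<close>, and
  continuity of the limit at \<open>t\<close> brings \<open>g (l t)\<close> close to
  \<open>g t\<close>.\<close>

lemma skorokhod_limit_pointwise:
  assumes T: "T > 0" and lim: "limitin (skorokhod_topology T) \<gamma> g sequentially"
    and cont: "isCont (\<lambda>s. g (stop T s)) t" and t: "t \<in> {0..T}"
  shows "(\<lambda>n. \<gamma> n t) \<longlonglongrightarrow> g t"
proof (rule metric_LIMSEQ_I)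
  fix r :: real assume r: "r > 0"
  have g: "g \<in> cadlag T" using limitin_topspace[OF lim] by simp
  obtain d where d: "d > 0" "\<And>s. \<bar>s - t\<bar> < d \<Longrightarrow> dist (g (stop T s)) (g (stop T t)) < r / 2"
    using cont r unfolding continuous_at_eps_delta by (metis dist_real_def half_gt_zero)
  obtain e0 where e0: "e0 > 0" "T * (exp e0 - 1) < d"
    using exp_displacement_small[OF d(1) T] .
  define e where "e = min e0 (r / 2)"
  have e: "e > 0" "e \<le> r / 2" using e0 r by (auto simp: e_def)
  have "T * (exp e - 1) \<le> T * (exp e0 - 1)" using T by (intro mult_left_mono) (auto simp: e_def)
  with e0 have ed: "T * (exp e - 1) < d" by simp
  obtain N where N: "\<And>n. n \<ge> N \<Longrightarrow> \<gamma> n \<in> cadlag T \<and> skorokhod_dist T (\<gamma> n) g < e"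
    using lim e unfolding skorokhod_topology_def
      Metric_space.limit_metric_sequentially[OF Metric_space_skorokhod] by blast
  have "dist (\<gamma> n t) (g t) < r" if n: "n \<ge> N" for n
  proof -
    obtain l where l: "l \<in> time_changes T" "\<bar>l t - t\<bar> \<le> T * (exp e - 1)"
      "norm (\<gamma> n t - g (l t)) \<le> e"
      using skorokhod_dist_less_time_change N[OF n] g t by metis
    have "l t \<in> {0..T}" using time_changesD(1)[OF l(1) t] .
    then have "dist (g (l t)) (g t) < r / 2"
      using d(2)[of "l t"] l(2) ed t by (simp add: stop_id)
    moreover have "dist (\<gamma> n t) (g (l t)) \<le> r / 2" using l(3) e by (simp add: dist_norm)
    ultimately show ?thesis using dist_triangle[of "\<gamma> n t" "g t" "g (l t)"] by simp
  qed
  then show "\<exists>N. \<forall>n\<ge>N. dist (\<gamma> n t) (g t) < r" by blast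
qed

text \<open>If \<open>f\<close> is in \<open>U\<close> at time \<open>s\<close>, a nearby path is in
  \<open>U\<close> at time \<open>l s\<close>. This time stays in \<open>V\<close>, either because
  \<open>V\<close> is relatively open and \<open>l s\<close> is close to \<open>s\<close>, or
  because \<open>V\<close> is the end point, which every time change fixes.\<close>

lemma openin_skorokhod_hits:
  fixes U :: "'a::real_normed_vector set"
  assumes T: "T > 0" and U: "open U" and V: "V = {T} \<or> V = {a<..<b} \<inter> {0..T}"
  shows "openin (skorokhod_topology T) {f \<in> cadlag T. \<exists>s\<in>V. f s \<in> U}"
  unfolding skorokhod_topology_def Metric_space.openin_mtopology[OF Metric_space_skorokhod]
proof (intro conjI allI impI)
  fix f assume "f \<in> {f \<in> cadlag T. \<exists>s\<in>V. f s \<in> U}"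
  then obtain s where f: "f \<in> cadlag T" and s: "s \<in> V" "f s \<in> U" by auto
  have sT: "s \<in> {0..T}" using V s(1) T by (elim disjE) auto
  obtain r where r: "r > 0" "ball (f s) r \<subseteq> U" using U s(2) open_contains_ball by blast
  have "\<exists>d>0. \<forall>l\<in>time_changes T. \<bar>l s - s\<bar> < d \<longrightarrow> l s \<in> V"
  proof (cases "V = {T}")
    case True
    then show ?thesis using s time_change_end T by (intro exI[of _ 1]) auto
  next
    case False
    then have "V = {a<..<b} \<inter> {0..T}" using V by blast
    then show ?thesis
      using s time_changesD(1)[OF _ sT]
      by (intro exI[of _ "min (s - a) (b - s)"]) (auto simp: abs_less_iff)
  qed
  then obtain d where d: "d > 0" "\<And>l. l \<in> time_changes T \<Longrightarrow> \<bar>l s - s\<bar> < d \<Longrightarrow> l s \<in> V"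
    by blast
  obtain e0 where e0: "e0 > 0" "T * (exp e0 - 1) < d"
    using exp_displacement_small[OF d(1) T] .
  define e where "e = min e0 (r / 2)"
  have e: "e > 0" "e < r" using e0 r by (auto simp: e_def)
  have "T * (exp e - 1) \<le> T * (exp e0 - 1)" using T by (intro mult_left_mono) (auto simp: e_def)
  with e0 have ed: "T * (exp e - 1) < d" by simp
  have "Metric_space.mball (cadlag T) (skorokhod_dist T) f e \<subseteq> {f \<in> cadlag T. \<exists>s\<in>V. f s \<in> U}"
  proof
    fix g assume "g \<in> Metric_space.mball (cadlag T) (skorokhod_dist T) f e"
    then have g: "g \<in> cadlag T" "skorokhod_dist T f g < e"
      by (auto simp: Metric_space.in_mball[OF Metric_space_skorokhod])
    obtain l where l: "l \<in> time_changes T" "\<bar>l s - s\<bar> \<le> T * (exp e - 1)"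
      "norm (f s - g (l s)) \<le> e"
      using skorokhod_dist_less_time_change[OF f g] sT by metis
    have "l s \<in> V" using d(2)[OF l(1)] l(2) ed by simp
    moreover have "g (l s) \<in> U" using l(3) e r(2) by (auto simp: dist_norm)
    ultimately show "g \<in> {f \<in> cadlag T. \<exists>s\<in>V. f s \<in> U}" using g by blast
  qed
  with e show "\<exists>r>0. Metric_space.mball (cadlag T) (skorokhod_dist T) f r
      \<subseteq> {f \<in> cadlag T. \<exists>s\<in>V. f s \<in> U}" by blast
qed auto

text \<open>Evaluation is not continuous, but for \<open>t < T\<close> right continuity gives \<open>f t \<in> U\<close> iff for some
  \<open>k\<close> and \<open>n\<close> the path stays in a closed set \<open>C k \<subseteq> U\<close> throughout \<open>(t, t + h n)\<close>, and leaving
  \<open>C k\<close> there is an open condition.\<close>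

lemma measurable_skorokhod_eval:
  assumes T: "T > 0" and t: "t \<in> {0..T}"
  shows "(\<lambda>f. f t) \<in> borel_of (skorokhod_topology T) \<rightarrow>\<^sub>M (borel :: 'a::real_normed_vector measure)"
proof (rule borel_measurableI)
  fix U :: "'a set" assume U: "open U"
  let ?B = "borel_of (skorokhod_topology T) :: (real \<Rightarrow> 'a) measure"
  have "{f \<in> cadlag T. f t \<in> U} \<in> sets ?B"
  \<comment> \<open>At \<open>T\<close> there is no right neighbourhood to use, but the end point is
    itself an admissible \<open>V\<close>. The case \<open>U = UNIV\<close> is set apart because
    \<open>infdist\<close> to the empty set is 0 by convention, which would make every
    \<open>C k\<close> empty.\<close>
  proof (cases "t = T \<or> U = UNIV")
    case True
    then show ?thesis
    proof
      assume "t = T"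
      then show ?thesis
        using openin_in_sets_borel_of[OF openin_skorokhod_hits[OF T U, of "{T}"]] by simp
    next
      assume "U = UNIV"
      then show ?thesis using sets.top[of ?B] by simp
    qed
  next
    case False
    then have tT: "t < T" and ne: "- U \<noteq> {}" using t by auto
    define h where "h n = inverse (real (Suc n))" for n
    define C where "C k = {x. infdist x (- U) \<ge> h k}" for k
    have C_closed: "closed (C k)" for k
      unfolding C_def by (intro closed_Collect_le continuous_intros)
    have C_sub: "C k \<subseteq> U" for k
    proof
      fix x assume x: "x \<in> C k"
      have "0 < h k" by (simp add: h_def)
      also have "h k \<le> infdist x (- U)" using x by (simp add: C_def)
      finally show "x \<in> U" by (cases "x \<in> U") auto
    qed
    define Q where "Q k n = {f \<in> cadlag T. \<exists>s\<in>{t<..<t + h n} \<inter> {0..T}. (f s :: 'a) \<in> - C k}" for k n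
    have Q: "Q k n \<in> sets ?B" for k n
      unfolding Q_def using C_closed[of k]
      by (intro openin_in_sets_borel_of openin_skorokhod_hits[OF T]) (auto simp: open_Compl)
    have "{f \<in> cadlag T. f t \<in> U} = (\<Union>k n. cadlag T - Q k n)"
    proof (intro equalityI subsetI)
      fix f :: "real \<Rightarrow> 'a" assume "f \<in> {f \<in> cadlag T. f t \<in> U}"
      then have f: "f \<in> cadlag T" "f t \<in> U" by auto
      have "infdist (f t) (- U) > 0"
        using U f(2) ne by (intro infdist_pos_not_in_closed) (auto simp: closed_Compl)
      then obtain k where k: "h k < infdist (f t) (- U)"
        unfolding h_def using reals_Archimedean by blast
      have "(f \<longlongrightarrow> f t) (at_right t)" using f(1) t tT by (auto simp: cadlag_def)
      then have "((\<lambda>s. infdist (f s) (- U)) \<longlongrightarrow> infdist (f t) (- U)) (at_right t)"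
        by (rule tendsto_infdist)
      then have "eventually (\<lambda>s. h k < infdist (f s) (- U)) (at_right t)"
        using k by (rule order_tendstoD(1))
      then obtain u where u: "u > t" "\<And>s. t < s \<Longrightarrow> s < u \<Longrightarrow> h k < infdist (f s) (- U)"
        unfolding eventually_at_right_field by blast
      obtain n where n: "h n < u - t" unfolding h_def using reals_Archimedean[of "u - t"] u(1) by auto
      have "f \<in> cadlag T - Q k n"
        using f(1) u(2) n by (fastforce simp: Q_def C_def)
      then show "f \<in> (\<Union>k n. cadlag T - Q k n)" by blast
    next
      fix f :: "real \<Rightarrow> 'a" assume "f \<in> (\<Union>k n. cadlag T - Q k n)"
      then obtain k n where f: "f \<in> cadlag T"
        "\<forall>s\<in>{t<..<t + h n} \<inter> {0..T}. f s \<in> C k" by (auto simp: Q_def)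
      have "(f \<longlongrightarrow> f t) (at_right t)" using f(1) t tT by (auto simp: cadlag_def)
      moreover have "eventually (\<lambda>s. f s \<in> C k) (at_right t)"
        unfolding eventually_at_right_field
      proof (intro exI[of _ "min T (t + h n)"] conjI allI impI)
        show "t < min T (t + h n)" using tT by (simp add: h_def)
        fix y assume "t < y" "y < min T (t + h n)"
        then show "f y \<in> C k" using t by (intro bspec[OF f(2)]) auto
      qed
      ultimately have "f t \<in> C k"
        using C_closed[of k] by (intro Lim_in_closed_set) auto
      then show "f \<in> {f \<in> cadlag T. f t \<in> U}" using f(1) C_sub by blast
    qed
    also have "\<dots> \<in> sets ?B"
    proof -
      have "cadlag T - Q k n \<in> sets ?B" for k n
        using sets.compl_sets[OF Q[of k n]] by simp
      then show ?thesis by (intro sets.countable_UN image_subsetI)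
    qed
    finally show ?thesis .
  qed
  then show "(\<lambda>f. f t) -` U \<inter> space ?B \<in> sets ?B"
    by (simp add: vimage_def Int_def conj_commute)
qed

section \<open>Adding continuous functions to paths\<close>

lemma cadlag_add_continuous:
  fixes c :: "real \<Rightarrow> 'a::real_normed_vector"
  assumes g: "g \<in> cadlag T" and c: "continuous_on UNIV c"
  shows "restrict (\<lambda>t. g t + c t) {0..T} \<in> cadlag T"
proof -
  have cont: "isCont c t" for t using c by (simp add: continuous_on_eq_continuous_at)
  have R: "(restrict (\<lambda>t. g t + c t) {0..T} \<longlongrightarrow> restrict (\<lambda>t. g t + c t) {0..T} t) (at_right t)"
    if t: "t \<in> {0..<T}" for t
  proof -
    have "((\<lambda>t. g t + c t) \<longlongrightarrow> g t + c t) (at_right t)"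
      using g t cont[of t] by (intro tendsto_add) (auto simp: cadlag_def filterlim_at_split isCont_def)
    moreover have "eventually (\<lambda>s. g s + c s = restrict (\<lambda>t. g t + c t) {0..T} s) (at_right t)"
      using t unfolding eventually_at_right_field by (intro exI[of _ T]) auto
    ultimately show ?thesis using t by (auto intro: Lim_transform_eventually)
  qed
  have L: "\<exists>l. (restrict (\<lambda>t. g t + c t) {0..T} \<longlongrightarrow> l) (at_left t)" if t: "t \<in> {0<..T}" for t
  proof -
    obtain l where "(g \<longlongrightarrow> l) (at_left t)" using g t unfolding cadlag_def by blast
    then have "((\<lambda>t. g t + c t) \<longlongrightarrow> l + c t) (at_left t)"
      using cont[of t] by (intro tendsto_add) (auto simp: filterlim_at_split isCont_def)
    moreover have "eventually (\<lambda>s. g s + c s = restrict (\<lambda>t. g t + c t) {0..T} s) (at_left t)"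
      using t unfolding eventually_at_left_field by (intro exI[of _ 0]) auto
    ultimately show ?thesis by (intro exI) (rule Lim_transform_eventually)
  qed
  show ?thesis unfolding cadlag_def by (intro CollectI conjI ballI restrict_extensional R L)
qed

text \<open>The time change that matches \<open>\<gamma> n\<close> with \<open>g\<close> also serves
  for the sums: its effect on \<open>c'\<close> is absorbed by uniform continuity, and replacing
  \<open>c n\<close> by \<open>c'\<close> costs little by uniform convergence.\<close>

lemma skorokhod_limit_add_continuous:
  fixes c :: "nat \<Rightarrow> real \<Rightarrow> 'a::real_normed_vector"
  assumes T: "T > 0" and lim: "limitin (skorokhod_topology T) \<gamma> g sequentially"
    and \<gamma>: "\<And>n. \<gamma> n \<in> cadlag T"
    and c: "\<And>n. continuous_on UNIV (c n)" "continuous_on UNIV c'"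
    and unif: "uniform_limit {0..T} c c' sequentially"
  shows "limitin (skorokhod_topology T) (\<lambda>n. restrict (\<lambda>t. \<gamma> n t + c n t) {0..T})
    (restrict (\<lambda>t. g t + c' t) {0..T}) sequentially"
  unfolding skorokhod_topology_def Metric_space.limit_metric_sequentially[OF Metric_space_skorokhod]
proof (intro conjI allI impI)
  have g: "g \<in> cadlag T" using limitin_topspace[OF lim] by simp
  show "restrict (\<lambda>t. g t + c' t) {0..T} \<in> cadlag T" by (rule cadlag_add_continuous[OF g c(2)])
  fix r :: real assume r: "r > 0"
  have "uniformly_continuous_on {0..T} c'"
    using c(2) by (intro compact_uniformly_continuous) (auto intro: continuous_on_subset)
  then obtain d where d: "d > 0"
    "\<And>s t. s \<in> {0..T} \<Longrightarrow> t \<in> {0..T} \<Longrightarrow> dist s t < d \<Longrightarrow> dist (c' s) (c' t) < r / 5"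
    using r unfolding uniformly_continuous_on_def by (metis divide_pos_pos zero_less_numeral)
  obtain e0 where e0: "e0 > 0" "T * (exp e0 - 1) < d"
    using exp_displacement_small[OF d(1) T] .
  define e where "e = min e0 (r / 5)"
  have e: "e > 0" "e \<le> r / 5" using e0 r by (auto simp: e_def)
  have "T * (exp e - 1) \<le> T * (exp e0 - 1)" using T by (intro mult_left_mono) (auto simp: e_def)
  with e0 have ed: "T * (exp e - 1) < d" by simp
  have "eventually (\<lambda>n. skorokhod_dist T (\<gamma> n) g < e) sequentially"
    using lim e unfolding skorokhod_topology_def
      Metric_space.limitin_metric[OF Metric_space_skorokhod] by (auto elim: eventually_mono)
  moreover have "eventually (\<lambda>n. \<forall>t\<in>{0..T}. dist (c n t) (c' t) < r / 5) sequentially"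
    using unif r by (intro uniform_limitD) auto
  ultimately have "eventually (\<lambda>n. skorokhod_dist T (restrict (\<lambda>t. \<gamma> n t + c n t) {0..T})
      (restrict (\<lambda>t. g t + c' t) {0..T}) < r) sequentially"
  proof eventually_elim
    case (elim n)
    obtain l where l: "l \<in> time_changes T" "time_change_norm T l \<le> ennreal e"
      "\<And>t. t \<in> {0..T} \<Longrightarrow> \<bar>l t - t\<bar> \<le> T * (exp e - 1)"
      "\<And>t. t \<in> {0..T} \<Longrightarrow> norm (\<gamma> n t - g (l t)) \<le> e"
      using skorokhod_dist_less_time_change[OF \<gamma> g elim(1)] by metis
    \<comment> \<open>One share \<open>e\<close> pays for the time change. Three shares of
      \<open>r / 5\<close> pay for the path gap, for \<open>c n\<close> against \<open>c'\<close>,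
      and for the shift of \<open>c'\<close>; altogether this is at most
      \<open>4 * r / 5\<close>.\<close>
    have "skorokhod_dist T (restrict (\<lambda>t. \<gamma> n t + c n t) {0..T})
        (restrict (\<lambda>t. g t + c' t) {0..T}) \<le> e + 3 * (r / 5)"
    proof (rule skorokhod_dist_leI[OF l(1,2)])
      fix t assume t: "t \<in> {0..T}"
      have lt: "l t \<in> {0..T}" by (rule time_changesD(1)[OF l(1) t])
      have "dist (c' t) (c' (l t)) < r / 5"
        using l(3)[OF t] ed by (intro d(2) t lt) (simp add: dist_real_def)
      moreover have "dist (c n t) (c' t) < r / 5" using elim(2) t by blast
      moreover have "norm (\<gamma> n t + c n t - (g (l t) + c' (l t)))
          = norm ((\<gamma> n t - g (l t)) + ((c n t - c' t) + (c' t - c' (l t))))"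
        by (simp add: algebra_simps)
      ultimately have "norm (\<gamma> n t + c n t - (g (l t) + c' (l t))) \<le> r / 5 + (r / 5 + r / 5)"
        using l(4)[OF t] e(2) norm_triangle_ineq[of "\<gamma> n t - g (l t)" "(c n t - c' t) + (c' t - c' (l t))"]
          norm_triangle_ineq[of "c n t - c' t" "c' t - c' (l t)"]
        unfolding dist_norm by linarith
      then show "norm (restrict (\<lambda>t. \<gamma> n t + c n t) {0..T} t
          - restrict (\<lambda>t. g t + c' t) {0..T} (l t)) \<le> 3 * (r / 5)"
        using t lt by (simp only: restrict_apply if_True)
    qed (use e r in auto)
    also have "\<dots> < r" using e r by simp
    finally show ?case .
  qed
  then show "\<exists>N. \<forall>n\<ge>N. restrict (\<lambda>t. \<gamma> n t + c n t) {0..T} \<in> cadlag T \<and>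
      skorokhod_dist T (restrict (\<lambda>t. \<gamma> n t + c n t) {0..T}) (restrict (\<lambda>t. g t + c' t) {0..T}) < r"
    unfolding eventually_sequentially using cadlag_add_continuous[OF \<gamma> c(1)] by blast
qed

section \<open>The Picard iteration\<close>

lemma bounded_set_integrable:
  fixes f :: "real \<Rightarrow> 'a::euclidean_space"
  assumes "f \<in> borel_measurable borel" "\<And>s. norm (f s) \<le> B"
  shows "set_integrable lborel {x..y} f"
  unfolding set_integrable_def
proof (rule Bochner_Integration.integrable_bound[where f = "\<lambda>s. indicator {x..y} s *\<^sub>R B"])
  show "integrable lborel (\<lambda>s. indicator {x..y} s *\<^sub>R B)"
    by (intro integrable_scaleR_left impI integrable_real_indicator) (auto simp: emeasure_lborel_Icc_eq)
  show "AE s in lborel. norm (indicator {x..y} s *\<^sub>R f s) \<le> norm (indicator {x..y} s *\<^sub>R B)"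
    using order_trans[OF assms(2) abs_ge_self] by (intro AE_I2) (simp split: split_indicator)
qed (use assms(1) in measurable)

locale mckean_vlasov =
  fixes T K :: real
    and \<rho> :: "('a::euclidean_space) measure \<Rightarrow> 'a measure \<Rightarrow> real"
    and b :: "'a \<Rightarrow> 'a measure \<Rightarrow> 'a"
    and \<nu> :: "('a \<times> (real \<Rightarrow> 'a)) measure"
  assumes T: "T > 0"
    and metric: "Metric_space (borel_prob euclidean) \<rho>"
    and weak: "metrizes_weak_convergence \<rho>"
    and dom: "dominated_by_expectation \<rho>"
    and lip: "\<And>x x' \<mu> \<mu>'. \<mu> \<in> borel_prob euclidean \<Longrightarrow> \<mu>' \<in> borel_prob euclidean \<Longrightarrow>
           norm (b x \<mu> - b x' \<mu>') \<le> K * (norm (x - x') + \<rho> \<mu> \<mu>')"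
    and bdd: "\<And>x \<mu>. \<mu> \<in> borel_prob euclidean \<Longrightarrow> norm (b x \<mu>) \<le> K"
    and nu: "\<nu> \<in> borel_prob (path_input_topology T)"
begin

abbreviation inputs :: "('a \<times> (real \<Rightarrow> 'a)) set" where
  "inputs \<equiv> UNIV \<times> cadlag T"

abbreviation drift :: "('a \<times> (real \<Rightarrow> 'a) \<Rightarrow> real \<Rightarrow> 'a) \<Rightarrow> 'a \<times> (real \<Rightarrow> 'a) \<Rightarrow> real \<Rightarrow> 'a" where
  "drift S p s \<equiv> mv_drift b \<nu> S s (S p s)"

section \<open>Laws of time marginals and the drift estimate\<close>

lemma prob_space_nu: "prob_space \<nu>"
  and sets_nu: "sets \<nu> = sets (borel_of (path_input_topology T))"
  using nu by (auto simp: borel_prob_def)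

lemma space_nu: "space \<nu> = inputs"
  using sets_eq_imp_space_eq[OF sets_nu] by simp

lemma law_in_borel_prob:
  "X \<in> borel_measurable \<nu> \<Longrightarrow> distr \<nu> borel X \<in> borel_prob euclidean"
  using prob_space.prob_space_distr[OF prob_space_nu, of X borel]
  by (simp add: borel_prob_def borel_of_euclidean)

lemma drift_le: "(\<lambda>p. S p s) \<in> borel_measurable \<nu> \<Longrightarrow> norm (drift S p s) \<le> K"
  unfolding mv_drift_def by (intro bdd law_in_borel_prob)

text \<open>The law of a constant map supplies a probability measure at which the bound on
  \<open>b\<close> can be read off.\<close>

lemma K_nonneg: "K \<ge> 0"
  by (rule order_trans[OF norm_ge_zero drift_le[of "\<lambda>p s. 0"]]) simp

text \<open>Dominated convergence passes pointwise convergence through bounded continuous test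
  functions, which is weak convergence of the laws, and \<open>\<rho>\<close> metrizes it. This
  serves to vary the time argument of the drift.\<close>

lemma law_tendsto:
  fixes X :: "nat \<Rightarrow> 'a \<times> (real \<Rightarrow> 'a) \<Rightarrow> 'a"
  assumes [measurable]: "\<And>n. X n \<in> borel_measurable \<nu>" "Y \<in> borel_measurable \<nu>"
    and lim: "\<And>p. p \<in> inputs \<Longrightarrow> (\<lambda>n. X n p) \<longlonglongrightarrow> Y p"
  shows "(\<lambda>n. \<rho> (distr \<nu> borel (X n)) (distr \<nu> borel Y)) \<longlonglongrightarrow> 0"
proof -
  interpret prob_space \<nu> by (rule prob_space_nu)
  have "limitin (Metric_space.mtopology (borel_prob euclidean) \<rho>)
      (\<lambda>n. distr \<nu> borel (X n)) (distr \<nu> borel Y) sequentially"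
  proof (subst weak[unfolded metrizes_weak_convergence_def, rule_format])
    show "range (\<lambda>n. distr \<nu> borel (X n)) \<subseteq> borel_prob euclidean"
      "distr \<nu> borel Y \<in> borel_prob euclidean"
      by (auto intro!: law_in_borel_prob assms(1,2))
    show "\<forall>\<phi>::'a \<Rightarrow> real. continuous_on UNIV \<phi> \<longrightarrow> bounded (range \<phi>) \<longrightarrow>
        (\<lambda>n. \<integral>x. \<phi> x \<partial>distr \<nu> borel (X n)) \<longlonglongrightarrow> (\<integral>x. \<phi> x \<partial>distr \<nu> borel Y)"
    proof (intro allI impI)
      fix \<phi> :: "'a \<Rightarrow> real" assume cont: "continuous_on UNIV \<phi>" and "bounded (range \<phi>)"
      then obtain B where B: "\<And>x. norm (\<phi> x) \<le> B" by (auto simp: bounded_iff)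
      have [measurable]: "\<phi> \<in> borel_measurable borel"
        using cont by (rule borel_measurable_continuous_onI)
      have "(\<lambda>n. \<integral>p. \<phi> (X n p) \<partial>\<nu>) \<longlonglongrightarrow> (\<integral>p. \<phi> (Y p) \<partial>\<nu>)"
      proof (rule integral_dominated_convergence[where w = "\<lambda>_. B"])
        have "(\<lambda>n. \<phi> (X n p)) \<longlonglongrightarrow> \<phi> (Y p)" if "p \<in> inputs" for p
          using continuous_on_tendsto_compose[OF cont lim[OF that]] by simp
        then show "AE p in \<nu>. (\<lambda>n. \<phi> (X n p)) \<longlonglongrightarrow> \<phi> (Y p)"
          by (intro AE_I2) (simp add: space_nu)
      qed (use B in auto)
      then show "(\<lambda>n. \<integral>x. \<phi> x \<partial>distr \<nu> borel (X n)) \<longlonglongrightarrow> (\<integral>x. \<phi> x \<partial>distr \<nu> borel Y)"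
        by (simp add: integral_distr)
    qed
  qed
  then show ?thesis by (simp add: Metric_space.limitin_metric_dist_null[OF metric])
qed

text \<open>Both variables live on \<open>\<nu>\<close>, which couples their laws; a uniform bound
  on the difference then bounds the expectation.\<close>

lemma law_dist_le:
  assumes [measurable]: "X \<in> borel_measurable \<nu>" "Y \<in> borel_measurable \<nu>"
    and le: "\<And>p. p \<in> inputs \<Longrightarrow> norm (X p - Y p) \<le> e" and e: "0 \<le> e"
  shows "\<rho> (distr \<nu> borel X) (distr \<nu> borel Y) \<le> e"
proof -
  interpret prob_space \<nu> by (rule prob_space_nu)
  have "ennreal (\<rho> (distr \<nu> borel X) (distr \<nu> borel Y)) \<le> (\<integral>\<^sup>+p. ennreal (norm (X p - Y p)) \<partial>\<nu>)"
    by (rule dominated_by_expectationD[OF dom prob_space_nu]) auto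
  also have "\<dots> \<le> (\<integral>\<^sup>+p. ennreal e \<partial>\<nu>)"
    by (intro nn_integral_mono ennreal_leI le) (simp add: space_nu)
  also have "\<dots> = ennreal e" by (simp add: emeasure_space_1)
  finally show ?thesis using e by (simp add: ennreal_le_iff)
qed

text \<open>This is the step from \<open>k\<close> to \<open>k + 1\<close> common to existence and
  uniqueness. The space argument and the law argument of \<open>b\<close> each differ by at most the
  assumed bound, which explains the factor \<open>2 * K\<close>, and integration in time raises the
  power and the factorial.\<close>

lemma drift_integral_diff_le:
  assumes meas: "\<And>s. s \<in> {0..T} \<Longrightarrow> (\<lambda>p. S p s) \<in> borel_measurable \<nu>"
      "\<And>s. s \<in> {0..T} \<Longrightarrow> (\<lambda>p. S' p s) \<in> borel_measurable \<nu>"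
    and C: "0 \<le> C"
    and le: "\<And>p s. p \<in> inputs \<Longrightarrow> s \<in> {0..T} \<Longrightarrow> norm (S p s - S' p s) \<le> C * (2 * K * s) ^ k / fact k"
    and p: "p \<in> inputs" and t: "t \<in> {0..T}"
    and int: "set_integrable lborel {0..t} (drift S p)" "set_integrable lborel {0..t} (drift S' p)"
  shows "norm ((LINT s:{0..t}|lborel. drift S p s) - (LINT s:{0..t}|lborel. drift S' p s))
    \<le> C * (2 * K * t) ^ Suc k / fact (Suc k)"
proof -
  define w where "w s = 2 * K * (C * (2 * K * s) ^ k / fact k)" for s
  \<comment> \<open>\<open>W\<close> is the antiderivative of \<open>w\<close>; it vanishes at 0
    because its exponent is positive even for \<open>k = 0\<close>.\<close>
  define W where "W s = C * (2 * K * s) ^ Suc k / fact (Suc k)" for s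
  have W: "DERIV W s :> w s" for s
    unfolding W_def[abs_def] w_def
    by (rule derivative_eq_intros refl | simp)+
  have "has_bochner_integral lborel (\<lambda>s. w s * indicator {0..t} s) (W t - W 0)"
    using t W by (intro has_bochner_integral_FTC_Icc_real) (auto simp: w_def[abs_def])
  then have w: "has_bochner_integral lborel (\<lambda>s. indicator {0..t} s *\<^sub>R w s) (W t)"
    by (simp add: W_def mult.commute)
  have "norm ((LINT s:{0..t}|lborel. drift S p s) - (LINT s:{0..t}|lborel. drift S' p s))
      = norm (LINT s:{0..t}|lborel. drift S p s - drift S' p s)"
    using int by (simp add: set_integral_diff)
  also have "\<dots> \<le> (LINT s:{0..t}|lborel. norm (drift S p s - drift S' p s))"
    using int by (intro set_integral_norm_bound set_integral_diff)
  also have "\<dots> \<le> (LINT s:{0..t}|lborel. w s)"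
  proof (rule set_integral_mono)
    show "set_integrable lborel {0..t} (\<lambda>s. norm (drift S p s - drift S' p s))"
      using int by (intro set_integrable_norm set_integral_diff)
    show "set_integrable lborel {0..t} w"
      using w by (simp add: set_integrable_def has_bochner_integral_iff)
    fix s assume "s \<in> {0..t}"
    then have s: "s \<in> {0..T}" using t by simp
    let ?e = "C * (2 * K * s) ^ k / fact k"
    have e: "0 \<le> ?e" using C K_nonneg s by (intro divide_nonneg_nonneg mult_nonneg_nonneg zero_le_power) auto
    have "norm (drift S p s - drift S' p s) \<le>
        K * (norm (S p s - S' p s) + \<rho> (distr \<nu> borel (\<lambda>p. S p s)) (distr \<nu> borel (\<lambda>p. S' p s)))"
      unfolding mv_drift_def by (intro lip law_in_borel_prob meas s)
    also have "\<dots> \<le> K * (?e + ?e)"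
      by (intro mult_left_mono add_mono law_dist_le meas s le p e K_nonneg)
    finally show "norm (drift S p s - drift S' p s) \<le> w s" by (simp add: w_def mult.assoc mult.left_commute)
  qed
  also have "\<dots> = W t" using w by (simp add: set_lebesgue_integral_def has_bochner_integral_iff)
  finally show ?thesis by (simp add: W_def)
qed

text \<open>The unknown is \<open>v p t = x\<^sub>t(p) - x\<^sub>0 - \<gamma>\<^sub>t\<close>, which unlike \<open>x\<close> itself is continuous both in
  time and in the input \<open>p = (x\<^sub>0, \<gamma>)\<close>.\<close>

definition traj :: "('a \<times> (real \<Rightarrow> 'a) \<Rightarrow> real \<Rightarrow> 'a) \<Rightarrow> 'a \<times> (real \<Rightarrow> 'a) \<Rightarrow> real \<Rightarrow> 'a" where
  "traj v p t = fst p + snd p (stop T t) + v p t"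

text \<open>Stopping the upper limit makes the result constant in time on either side of
  \<open>[0, T]\<close>, so it is continuous on the whole line for regular \<open>v\<close>.\<close>

definition picard :: "('a \<times> (real \<Rightarrow> 'a) \<Rightarrow> real \<Rightarrow> 'a) \<Rightarrow> 'a \<times> (real \<Rightarrow> 'a) \<Rightarrow> real \<Rightarrow> 'a" where
  "picard v p t = (LINT s:{0..stop T t}|lborel. drift (traj v) p s)"

text \<open>Continuity in \<open>p\<close> replaces joint measurability in \<open>(p, t)\<close>: it gives measurable time marginals
  and is preserved by \<open>picard\<close> through dominated convergence.\<close>

definition regular :: "('a \<times> (real \<Rightarrow> 'a) \<Rightarrow> real \<Rightarrow> 'a) \<Rightarrow> bool" where
  "regular v \<longleftrightarrow>
     (\<forall>\<sigma> p t. range \<sigma> \<subseteq> inputs \<longrightarrow> limitin (path_input_topology T) \<sigma> p sequentially \<longrightarrow>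
        (\<lambda>n. v (\<sigma> n) t) \<longlonglongrightarrow> v p t) \<and>
     (\<forall>p\<in>inputs. continuous_on UNIV (v p))"

lemma regularD:
  assumes "regular v"
  shows "range \<sigma> \<subseteq> inputs \<Longrightarrow> limitin (path_input_topology T) \<sigma> p sequentially \<Longrightarrow>
      (\<lambda>n. v (\<sigma> n) t) \<longlonglongrightarrow> v p t"
    and "p \<in> inputs \<Longrightarrow> continuous_on UNIV (v p)"
  using assms unfolding regular_def by blast+

section \<open>Regularity of trajectories, drift and Picard map\<close>

lemma metrizable_path_input: "metrizable_space (path_input_topology T :: ('a \<times> (real \<Rightarrow> 'a)) topology)"
  unfolding skorokhod_topology_def metrizable_space_prod_topology
  using metrizable_space_euclidean Metric_space.metrizable_space_mtopology[OF Metric_space_skorokhod]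
  by blast

text \<open>Composition with the Borel evaluation map. It covers competing solutions, about which
  only measurability into the path space is known.\<close>

lemma measurable_eval:
  assumes S: "S \<in> borel_of (path_input_topology T) \<rightarrow>\<^sub>M borel_of (skorokhod_topology T)" and t: "t \<in> {0..T}"
  shows "(\<lambda>p. S p t :: 'a) \<in> borel_measurable \<nu>"
  using measurable_compose[OF S measurable_skorokhod_eval[OF T t]]
  by (simp add: measurable_cong_sets[OF sets_nu refl])

lemma traj_measurable:
  assumes v: "regular v"
  shows "(\<lambda>p. traj v p t) \<in> borel_measurable \<nu>"
proof -
  have cts: "f \<in> borel_measurable \<nu>" if "continuous_map (path_input_topology T) euclidean f"
    for f :: "'a \<times> (real \<Rightarrow> 'a) \<Rightarrow> 'a"
    using continuous_map_measurable_borel_of[OF that]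
    by (simp add: measurable_cong_sets[OF sets_nu refl] borel_of_euclidean)
  have [measurable]: "fst \<in> borel_measurable \<nu>"
    by (intro cts continuous_map_fst)
  have [measurable]: "(\<lambda>p. v p t) \<in> borel_measurable \<nu>"
    by (intro cts continuous_map_sequentiallyI metrizable_path_input)
      (use regularD(1)[OF v] in auto)
  \<comment> \<open>Unlike the other two summands this one need not be continuous in
    \<open>p\<close>, so it goes through the measurability of evaluation.\<close>
  have [measurable]: "(\<lambda>p. snd p (stop T t)) \<in> borel_measurable \<nu>"
    by (intro measurable_eval continuous_map_measurable_borel_of continuous_map_snd) (simp add: T)
  show ?thesis unfolding traj_def by measurable
qed

lemma traj_right_continuous:
  assumes v: "regular v" and p: "p \<in> inputs"
  shows "(traj v p \<longlongrightarrow> traj v p t) (at_right t)"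
proof -
  have "isCont (v p) t" using regularD(2)[OF v p] by (simp add: continuous_on_eq_continuous_at)
  then have "(v p \<longlongrightarrow> v p t) (at_right t)" by (simp add: isCont_def filterlim_at_split)
  moreover have "((\<lambda>s. snd p (stop T s)) \<longlongrightarrow> snd p (stop T t)) (at_right t)"
    using p by (intro right_continuous_stopped T) auto
  ultimately show ?thesis
    unfolding traj_def[abs_def] by (intro tendsto_intros)
qed

text \<open>As \<open>s\<close> decreases to \<open>t\<close>, the trajectories of all inputs
  converge, hence so do their laws, and the Lipschitz condition carries this over to the drift.
  Borel measurability of the drift in time follows.\<close>

lemma drift_right_continuous:
  assumes v: "regular v" and p: "p \<in> inputs"
  shows "(drift (traj v) p \<longlongrightarrow> drift (traj v) p t) (at_right t)"
  unfolding tendsto_at_iff_sequentially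
proof (intro allI impI)
  fix s :: "nat \<Rightarrow> real" assume s: "\<forall>i. s i \<in> {t<..} - {t}" "s \<longlonglongrightarrow> t"
  have lim: "(\<lambda>n. traj v q (s n)) \<longlonglongrightarrow> traj v q t" if "q \<in> inputs" for q
    using traj_right_continuous[OF v that, of t] s
    unfolding tendsto_at_iff_sequentially by (auto simp: o_def)
  let ?\<mu> = "\<lambda>s. distr \<nu> borel (\<lambda>q. traj v q s)"
  have "(\<lambda>n. K * (norm (traj v p (s n) - traj v p t) + \<rho> (?\<mu> (s n)) (?\<mu> t))) \<longlonglongrightarrow> K * (0 + 0)"
    by (intro tendsto_intros law_tendsto traj_measurable v lim tendsto_norm_zero LIM_zero p)
  then have "(\<lambda>n. K * (norm (traj v p (s n) - traj v p t) + \<rho> (?\<mu> (s n)) (?\<mu> t))) \<longlonglongrightarrow> 0" by simp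
  moreover have "norm (drift (traj v) p (s n) - drift (traj v) p t)
      \<le> K * (norm (traj v p (s n) - traj v p t) + \<rho> (?\<mu> (s n)) (?\<mu> t))" for n
    unfolding mv_drift_def by (intro lip law_in_borel_prob traj_measurable v)
  ultimately have "(\<lambda>n. drift (traj v) p (s n) - drift (traj v) p t) \<longlonglongrightarrow> 0"
    by (rule Lim_null_comparison[OF always_eventually[OF allI], rotated])
  then show "(drift (traj v) p \<circ> s) \<longlonglongrightarrow> drift (traj v) p t"
    unfolding o_def by (rule LIM_zero_cancel)
qed

lemma drift_measurable:
  "regular v \<Longrightarrow> p \<in> inputs \<Longrightarrow> drift (traj v) p \<in> borel_measurable borel"
  by (intro borel_measurable_right_continuous drift_right_continuous)

lemma drift_integrable:
  "regular v \<Longrightarrow> p \<in> inputs \<Longrightarrow> set_integrable lborel {x..y} (drift (traj v) p)"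
  by (intro bounded_set_integrable[where B = K] drift_measurable drift_le traj_measurable)

lemma stop_stop: "stop T (stop T t) = stop T t"
  by (rule stop_id) (simp add: T)

text \<open>Extending the integral to all of \<open>[0, T]\<close> gives a bound free of
  \<open>t\<close>, which later yields continuity in the input uniformly in time.\<close>

lemma norm_picard_diff_le:
  assumes v: "regular v" and p: "p \<in> inputs" "q \<in> inputs"
  shows "norm (picard v q t - picard v p t)
    \<le> (LINT s:{0..T}|lborel. norm (drift (traj v) q s - drift (traj v) p s))"
proof -
  let ?f = "\<lambda>s. drift (traj v) q s - drift (traj v) p s"
  have int: "set_integrable lborel {0..u} ?f" for u
    by (intro set_integral_diff drift_integrable v p)
  have "norm (picard v q t - picard v p t) = norm (LINT s:{0..stop T t}|lborel. ?f s)"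
    unfolding picard_def by (simp add: set_integral_diff drift_integrable v p)
  also have "\<dots> \<le> (LINT s:{0..stop T t}|lborel. norm (?f s))"
    by (rule set_integral_norm_bound[OF int])
  also have "\<dots> \<le> (LINT s:{0..T}|lborel. norm (?f s))"
    unfolding set_lebesgue_integral_def using set_integrable_norm[OF int] stop_bounds(2)[OF T, of t]
    by (intro integral_mono) (auto simp: set_integrable_def split: split_indicator)
  finally show ?thesis .
qed

text \<open>At almost every time the limiting path is continuous, so the trajectories converge there
  and the drift with them; \<open>2 * K\<close> dominates the integrands.\<close>

lemma drift_diff_integral_tendsto:
  assumes v: "regular v" and \<sigma>: "range \<sigma> \<subseteq> inputs" "limitin (path_input_topology T) \<sigma> p sequentially"
  shows "(\<lambda>n. LINT s:{0..T}|lborel. norm (drift (traj v) (\<sigma> n) s - drift (traj v) p s)) \<longlonglongrightarrow> 0"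
proof -
  have p: "p \<in> inputs" using limitin_topspace[OF \<sigma>(2)] by simp
  have \<sigma>n: "\<sigma> n \<in> inputs" for n using \<sigma>(1) by blast
  have lim: "(\<lambda>n. fst (\<sigma> n)) \<longlonglongrightarrow> fst p"
    "limitin (skorokhod_topology T) (\<lambda>n. snd (\<sigma> n)) (snd p) sequentially"
    using \<sigma>(2) by (simp_all add: limitin_pairwise o_def)
  have "(\<lambda>n. LINT s:{0..T}|lborel. norm (drift (traj v) (\<sigma> n) s - drift (traj v) p s))
      \<longlonglongrightarrow> (LINT s:{0..T}|lborel. (0::real))"
    unfolding set_lebesgue_integral_def
  proof (rule integral_dominated_convergence[where w = "\<lambda>s. indicator {0..T} s *\<^sub>R (2 * K)"])
    show "integrable lborel (\<lambda>s. indicator {0..T} s *\<^sub>R (2 * K))"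
      by (intro integrable_scaleR_left impI integrable_real_indicator) (auto simp: emeasure_lborel_Icc_eq)
    show "(\<lambda>s. indicator {0..T} s *\<^sub>R norm (drift (traj v) (\<sigma> n) s - drift (traj v) p s))
        \<in> borel_measurable lborel" for n
      using drift_measurable[OF v \<sigma>n, of n] drift_measurable[OF v p] by measurable
    show "AE s in lborel. norm (indicator {0..T} s *\<^sub>R norm (drift (traj v) (\<sigma> n) s - drift (traj v) p s))
        \<le> indicator {0..T} s *\<^sub>R (2 * K)" for n
    proof (rule AE_I2)
      fix s
      have "norm (drift (traj v) (\<sigma> n) s - drift (traj v) p s) \<le> K + K"
        by (rule order_trans[OF norm_triangle_ineq4])
          (intro add_mono drift_le traj_measurable v)
      then show "norm (indicator {0..T} s *\<^sub>R norm (drift (traj v) (\<sigma> n) s - drift (traj v) p s))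
          \<le> indicator {0..T} s *\<^sub>R (2 * K)"
        by (simp split: split_indicator)
    qed
    have "AE s in lborel. isCont (\<lambda>s. snd p (stop T s)) s"
      using p by (intro AE_isCont_right_continuous right_continuous_stopped T) auto
    then show "AE s in lborel. (\<lambda>n. indicator {0..T} s *\<^sub>R norm (drift (traj v) (\<sigma> n) s - drift (traj v) p s))
        \<longlonglongrightarrow> indicator {0..T} s *\<^sub>R 0"
    proof eventually_elim
      case (elim s)
      show ?case
      proof (cases "s \<in> {0..T}")
        case True
        have "(\<lambda>n. traj v (\<sigma> n) s) \<longlonglongrightarrow> traj v p s"
          unfolding traj_def stop_id[OF True]
          by (intro tendsto_intros lim(1) skorokhod_limit_pointwise[OF T lim(2) elim True] regularD(1)[OF v \<sigma>])
        then have "(\<lambda>n. K * (norm (traj v (\<sigma> n) s - traj v p s) + 0)) \<longlonglongrightarrow> K * (0 + 0)"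
          by (intro tendsto_intros tendsto_norm_zero LIM_zero)
        then have "(\<lambda>n. K * norm (traj v (\<sigma> n) s - traj v p s)) \<longlonglongrightarrow> 0" by simp
        \<comment> \<open>Changing the input does not change the law at time \<open>s\<close>, as
          that law averages over all inputs; the \<open>\<rho>\<close> term is therefore 0.\<close>
        moreover have "norm (drift (traj v) (\<sigma> n) s - drift (traj v) p s)
            \<le> K * norm (traj v (\<sigma> n) s - traj v p s)" for n
          using lip[OF law_in_borel_prob[OF traj_measurable[OF v]] law_in_borel_prob[OF traj_measurable[OF v]],
              of "traj v (\<sigma> n) s" s "traj v p s" s]
            Metric_space.mdist_zero[OF metric law_in_borel_prob[OF traj_measurable[OF v, of s]]]
          by (simp add: mv_drift_def)
        ultimately have "(\<lambda>n. drift (traj v) (\<sigma> n) s - drift (traj v) p s) \<longlonglongrightarrow> 0"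
          by (rule Lim_null_comparison[OF always_eventually[OF allI], rotated])
        then show ?thesis using True by (simp add: tendsto_norm_zero)
      qed simp
    qed
  qed simp
  then show ?thesis by simp
qed

lemma regular_picard:
  assumes v: "regular v"
  shows "regular (picard v)"
  unfolding regular_def
proof (intro conjI allI impI ballI)
  fix \<sigma> p t assume \<sigma>: "range \<sigma> \<subseteq> inputs" "limitin (path_input_topology T) \<sigma> p sequentially"
  have p: "p \<in> inputs" using limitin_topspace[OF \<sigma>(2)] by simp
  have "norm (picard v (\<sigma> n) t - picard v p t)
      \<le> (LINT s:{0..T}|lborel. norm (drift (traj v) (\<sigma> n) s - drift (traj v) p s))" for n
    using \<sigma>(1) by (intro norm_picard_diff_le v p) blast
  then have "(\<lambda>n. picard v (\<sigma> n) t - picard v p t) \<longlonglongrightarrow> 0"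
    by (rule Lim_null_comparison[OF always_eventually[OF allI] drift_diff_integral_tendsto[OF v \<sigma>]])
  then show "(\<lambda>n. picard v (\<sigma> n) t) \<longlonglongrightarrow> picard v p t" by (rule LIM_zero_cancel)
next
  fix p :: "'a \<times> (real \<Rightarrow> 'a)" assume p: "p \<in> inputs"
  let ?f = "drift (traj v) p"
  \<comment> \<open>Passing to the gauge integral gives access to the continuity of indefinite
    integrals.\<close>
  have eq: "picard v p = (\<lambda>t. integral {0..stop T t} ?f)"
    unfolding picard_def by (intro ext set_borel_integral_eq_integral(2) drift_integrable v p)
  have "continuous_on {0..T} (\<lambda>t. integral {0..t} ?f)"
    by (intro indefinite_integral_continuous_1 set_borel_integral_eq_integral(1) drift_integrable v p)
  moreover have "continuous_on UNIV (stop T)"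
    unfolding stop_def[abs_def] by (intro continuous_intros)
  ultimately show "continuous_on UNIV (picard v p)"
    unfolding eq by (rule continuous_on_compose2) (use T in auto)
qed

text \<open>The summands \<open>x\<^sub>0\<close> and \<open>\<gamma>\<close> cancel in the
  difference of two trajectories, leaving \<open>v p s - w p s\<close>.\<close>

lemma picard_diff_le:
  assumes v: "regular v" and w: "regular w" and C: "0 \<le> C"
    and le: "\<And>p s. p \<in> inputs \<Longrightarrow> s \<in> {0..T} \<Longrightarrow> norm (v p s - w p s) \<le> C * (2 * K * s) ^ k / fact k"
    and p: "p \<in> inputs" and t: "t \<in> {0..T}"
  shows "norm (picard v p t - picard w p t) \<le> C * (2 * K * t) ^ Suc k / fact (Suc k)"
  unfolding picard_def stop_id[OF t]
  by (intro drift_integral_diff_le traj_measurable drift_integrable v w C p t)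
    (use le in \<open>auto simp: traj_def\<close>)

lemma norm_picard_le:
  assumes v: "regular v" and p: "p \<in> inputs" and t: "t \<in> {0..T}"
  shows "norm (picard v p t) \<le> K * T"
proof -
  have "norm (picard v p t) \<le> (LINT s:{0..t}|lborel. norm (drift (traj v) p s))"
    unfolding picard_def stop_id[OF t] by (intro set_integral_norm_bound drift_integrable v p)
  also have "\<dots> \<le> (LINT s:{0..t}|lborel. K)"
    by (intro set_integral_mono set_integrable_norm drift_integrable v p drift_le traj_measurable)
      (simp add: set_integrable_def, intro integrable_real_indicator disjI2, auto simp: emeasure_lborel_Icc_eq)
  also have "\<dots> = K * t" using t by (simp add: set_lebesgue_integral_def)
  also have "\<dots> \<le> K * T" using t K_nonneg by (intro mult_left_mono) auto
  finally show ?thesis .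
qed

section \<open>Convergence of the iterates\<close>

definition iter :: "nat \<Rightarrow> 'a \<times> (real \<Rightarrow> 'a) \<Rightarrow> real \<Rightarrow> 'a" where
  "iter n = (picard ^^ n) (\<lambda>p t. 0)"

lemma iter_Suc: "iter (Suc n) = picard (iter n)"
  and iter_0: "iter 0 = (\<lambda>p t. 0)"
  by (simp_all add: iter_def)

lemma regular_iter: "regular (iter n)"
proof (induction n)
  case 0
  then show ?case by (simp add: iter_0 regular_def)
qed (simp add: iter_Suc regular_picard)

text \<open>The constant \<open>K * T\<close> bounds the first iterate, the iteration starting at 0;
  each further step contributes one power and one factor of the factorial.\<close>

lemma iter_diff_le:
  "p \<in> inputs \<Longrightarrow> t \<in> {0..T} \<Longrightarrow>
    norm (iter (Suc n) p t - iter n p t) \<le> (K * T) * (2 * K * t) ^ n / fact n"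
proof (induction n arbitrary: p t)
  case 0
  then show ?case using norm_picard_le[OF regular_iter[of 0]] by (simp add: iter_Suc iter_0)
next
  case (Suc n)
  have "norm (picard (iter (Suc n)) p t - picard (iter n) p t)
      \<le> (K * T) * (2 * K * t) ^ Suc n / fact (Suc n)"
    using K_nonneg T by (intro picard_diff_le regular_iter Suc) auto
  then show ?case by (simp only: iter_Suc)
qed

lemma iter_stop: "iter n p (stop T t) = iter n p t"
  by (cases n) (simp_all add: iter_0 iter_Suc picard_def stop_stop)

text \<open>The limit of the iterates, written as a telescoping series to fit the Weierstrass
  test.\<close>

definition sol :: "'a \<times> (real \<Rightarrow> 'a) \<Rightarrow> real \<Rightarrow> 'a" where
  "sol p t = (\<Sum>n. iter (Suc n) p t - iter n p t)"

lemma uniform_limit_iter: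
  "uniform_limit (inputs \<times> UNIV) (\<lambda>n (p, t). iter n p t) (\<lambda>(p, t). sol p t) sequentially"
proof -
  have "uniform_limit (inputs \<times> UNIV)
      (\<lambda>n x. \<Sum>i<n. iter (Suc i) (fst x) (snd x) - iter i (fst x) (snd x))
      (\<lambda>x. \<Sum>i. iter (Suc i) (fst x) (snd x) - iter i (fst x) (snd x)) sequentially"
  proof (rule Weierstrass_m_test)
    show "summable (\<lambda>n. (K * T) * (inverse (fact n) * (2 * K * T) ^ n))"
      by (intro summable_mult summable_exp)
    fix n :: nat and x :: "('a \<times> (real \<Rightarrow> 'a)) \<times> real" assume x: "x \<in> inputs \<times> UNIV"
    \<comment> \<open>The estimate on increments holds on \<open>[0, T]\<close> only; the iterates
      do not see the difference between a time and its stopped value.\<close>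
    let ?t = "stop T (snd x)"
    have t: "?t \<in> {0..T}" by (simp add: T)
    have "norm (iter (Suc n) (fst x) ?t - iter n (fst x) ?t) \<le> (K * T) * (2 * K * ?t) ^ n / fact n"
      using x t by (intro iter_diff_le) auto
    also have "\<dots> \<le> (K * T) * (2 * K * T) ^ n / fact n"
      using t K_nonneg T by (intro divide_right_mono mult_left_mono power_mono) auto
    also have "\<dots> = (K * T) * (inverse (fact n) * (2 * K * T) ^ n)" by (simp add: field_simps)
    finally show "norm (iter (Suc n) (fst x) (snd x) - iter n (fst x) (snd x))
        \<le> (K * T) * (inverse (fact n) * (2 * K * T) ^ n)"
      by (simp only: iter_stop)
  qed
  moreover have "(\<Sum>i<n. iter (Suc i) p t - iter i p t) = iter n p t" for n p t
    using sum_lessThan_telescope[of "\<lambda>i. iter i p t" n] by (simp add: iter_0)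
  ultimately show ?thesis by (simp add: sol_def case_prod_unfold)
qed

lemma iter_close:
  assumes "e > 0"
  obtains n where "\<And>p t m. n \<le> m \<Longrightarrow> p \<in> inputs \<Longrightarrow> norm (iter m p t - sol p t) < e"
proof -
  have "eventually (\<lambda>n. \<forall>x\<in>inputs \<times> UNIV. dist (case_prod (iter n) x) (case_prod sol x) < e) sequentially"
    using uniform_limitD[OF uniform_limit_iter assms] by (simp add: case_prod_unfold)
  then show thesis using that unfolding eventually_sequentially dist_norm by fastforce
qed

text \<open>Uniformity over the inputs permits exchanging the limit in \<open>n\<close> with the one
  along \<open>\<sigma>\<close>; uniformity over time preserves continuity in
  \<open>t\<close>.\<close>

lemma regular_sol: "regular sol"
  unfolding regular_def
proof (intro conjI allI impI ballI)
  fix \<sigma> p t assume \<sigma>: "range \<sigma> \<subseteq> inputs" "limitin (path_input_topology T) \<sigma> p sequentially"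
  have p: "p \<in> inputs" using limitin_topspace[OF \<sigma>(2)] by simp
  show "(\<lambda>n. sol (\<sigma> n) t) \<longlonglongrightarrow> sol p t"
  proof (rule swap_uniform_limit')
    show "\<forall>\<^sub>F n in sequentially. (\<lambda>m. iter n (\<sigma> m) t) \<longlonglongrightarrow> iter n p t"
      by (intro always_eventually allI regularD(1) regular_iter \<sigma>)
    show "(\<lambda>n. iter n p t) \<longlonglongrightarrow> sol p t"
      using tendsto_uniform_limitI[OF uniform_limit_iter, of "(p, t)"] p by simp
    show "uniform_limit UNIV (\<lambda>n m. iter n (\<sigma> m) t) (\<lambda>m. sol (\<sigma> m) t) sequentially"
      using uniform_limit_compose'[OF uniform_limit_iter, of "\<lambda>m. (\<sigma> m, t)" UNIV] \<sigma>(1) by auto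
  qed auto
next
  fix p :: "'a \<times> (real \<Rightarrow> 'a)" assume p: "p \<in> inputs"
  show "continuous_on UNIV (sol p)"
  proof (rule uniform_limit_theorem)
    show "uniform_limit UNIV (\<lambda>n. iter n p) (sol p) sequentially"
      using uniform_limit_compose'[OF uniform_limit_iter, of "\<lambda>t. (p, t)" UNIV] p by auto
    show "\<forall>\<^sub>F n in sequentially. continuous_on UNIV (iter n p)"
      by (intro always_eventually allI regularD(2) regular_iter p)
  qed simp
qed

text \<open>The iterate \<open>iter (Suc n)\<close> is close to \<open>sol\<close> and also to
  \<open>picard sol\<close>, because \<open>picard\<close> enlarges a uniform distance at most by
  the factor \<open>2 * K * T\<close>.\<close>

lemma picard_sol:
  assumes p: "p \<in> inputs" and t: "t \<in> {0..T}"
  shows "picard sol p t = sol p t"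
proof -
  have "norm (picard sol p t - sol p t) \<le> e" if e: "e > 0" for e
  proof -
    \<comment> \<open>Chosen so that \<open>d * (2 * K * T) + d = e\<close>: the first summand is
      the error after applying \<open>picard\<close>, the second that of the iterate itself.\<close>
    define d where "d = e / (2 * K * T + 1)"
    have pos: "2 * K * T + 1 > 0" using K_nonneg T by (simp add: add_nonneg_pos)
    then have d: "d > 0" using e by (simp add: d_def)
    obtain n where n: "\<And>p t m. n \<le> m \<Longrightarrow> p \<in> inputs \<Longrightarrow> norm (iter m p t - sol p t) < d"
      using iter_close[OF d] by blast
    have "norm (picard sol p t - picard (iter n) p t) \<le> d * (2 * K * t) ^ Suc 0 / fact (Suc 0)"
      using n[OF order_refl] d
      by (intro picard_diff_le regular_sol regular_iter p t) (auto simp: norm_minus_commute less_imp_le)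
    also have "\<dots> \<le> d * (2 * K * T)" using d t K_nonneg by (simp add: mult_left_mono)
    finally have "norm (picard sol p t - iter (Suc n) p t) \<le> d * (2 * K * T)" by (simp add: iter_Suc)
    moreover have "norm (iter (Suc n) p t - sol p t) \<le> d" using n[of "Suc n"] p by (simp add: less_imp_le)
    ultimately have "norm (picard sol p t - sol p t) \<le> d * (2 * K * T) + d"
      using norm_triangle_ineq[of "picard sol p t - iter (Suc n) p t" "iter (Suc n) p t - sol p t"] by simp
    also have "\<dots> = d * (2 * K * T + 1)" by (simp add: algebra_simps)
    also have "\<dots> = e" using pos by (simp add: d_def)
    finally show ?thesis .
  qed
  then have "norm (picard sol p t - sol p t) \<le> 0" by (rule field_le_epsilon) simp
  then show ?thesis by simp
qed

section \<open>Existence and uniqueness of the solution map\<close>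

definition solution_map :: "'a \<times> (real \<Rightarrow> 'a) \<Rightarrow> real \<Rightarrow> 'a" where
  "solution_map = restrict (\<lambda>p. restrict (\<lambda>t. snd p t + (fst p + sol p t)) {0..T}) inputs"

lemma solution_map_eq_traj:
  "p \<in> inputs \<Longrightarrow> t \<in> {0..T} \<Longrightarrow> solution_map p t = traj sol p t"
  by (simp only: solution_map_def restrict_apply if_True traj_def stop_id) (simp add: algebra_simps)

text \<open>The fixed point equation turns the time-free bound on differences of
  \<open>picard\<close> into uniform convergence of \<open>sol (\<sigma> n)\<close>. The driving
  paths converge only in the Skorokhod sense, and the continuous remainder is added to them.\<close>

lemma solution_map_continuous:
  "continuous_map (path_input_topology T) (skorokhod_topology T) solution_map"
proof (rule continuous_map_sequentiallyI[OF metrizable_path_input])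
  have cont: "continuous_on UNIV (\<lambda>t. fst p + sol p t)" if "p \<in> inputs" for p
    using regularD(2)[OF regular_sol that] by (intro continuous_intros)
  show "solution_map \<in> topspace (path_input_topology T) \<rightarrow> topspace (skorokhod_topology T)"
    using cadlag_add_continuous[OF _ cont] by (auto simp: solution_map_def)
  fix \<sigma> :: "nat \<Rightarrow> 'a \<times> (real \<Rightarrow> 'a)" and p
  assume \<sigma>': "range \<sigma> \<subseteq> topspace (path_input_topology T)"
    and lim: "limitin (path_input_topology T) \<sigma> p sequentially"
  then have \<sigma>: "range \<sigma> \<subseteq> inputs" by simp
  then have \<sigma>n: "\<sigma> n \<in> inputs" for n by blast
  have p: "p \<in> inputs" using limitin_topspace[OF lim] by simp
  have lims: "(\<lambda>n. fst (\<sigma> n)) \<longlonglongrightarrow> fst p"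
    "limitin (skorokhod_topology T) (\<lambda>n. snd (\<sigma> n)) (snd p) sequentially"
    using lim by (simp_all add: limitin_pairwise o_def)
  let ?I = "\<lambda>n. LINT s:{0..T}|lborel. norm (drift (traj sol) (\<sigma> n) s - drift (traj sol) p s)"
  have "uniform_limit {0..T} (\<lambda>n t. sol (\<sigma> n) t) (sol p) sequentially"
  proof (rule uniform_limitI)
    fix e :: real assume "e > 0"
    then have "eventually (\<lambda>n. ?I n < e) sequentially"
      using drift_diff_integral_tendsto[OF regular_sol \<sigma> lim] by (intro order_tendstoD(2)) auto
    then show "\<forall>\<^sub>F n in sequentially. \<forall>t\<in>{0..T}. dist (sol (\<sigma> n) t) (sol p t) < e"
    proof eventually_elim
      case (elim n)
      show ?case
      proof
        fix t assume t: "t \<in> {0..T}"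
        show "dist (sol (\<sigma> n) t) (sol p t) < e"
          using norm_picard_diff_le[OF regular_sol p \<sigma>n, of n t] elim
          by (simp add: picard_sol[OF \<sigma>n t] picard_sol[OF p t] dist_norm)
      qed
    qed
  qed
  moreover have "uniform_limit {0..T} (\<lambda>n t. fst (\<sigma> n)) (\<lambda>t. fst p) sequentially"
    using lims(1) by (auto simp: uniform_limit_iff tendsto_iff elim: eventually_mono)
  ultimately have "uniform_limit {0..T} (\<lambda>n t. fst (\<sigma> n) + sol (\<sigma> n) t) (\<lambda>t. fst p + sol p t) sequentially"
    by (intro uniform_limit_add)
  then have "limitin (skorokhod_topology T)
      (\<lambda>n. restrict (\<lambda>t. snd (\<sigma> n) t + (fst (\<sigma> n) + sol (\<sigma> n) t)) {0..T})
      (restrict (\<lambda>t. snd p t + (fst p + sol p t)) {0..T}) sequentially"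
    by (intro skorokhod_limit_add_continuous[OF T lims(2)] cont p \<sigma>n)
      (use \<sigma>n in \<open>simp add: mem_Times_iff\<close>)
  then show "limitin (skorokhod_topology T) (\<lambda>n. solution_map (\<sigma> n)) (solution_map p) sequentially"
    using \<sigma>n p by (simp only: solution_map_def restrict_apply if_True)
qed

lemma solution_map_solves: "solves_mv_equation T b \<nu> solution_map"
  unfolding solves_mv_equation_def
proof (intro allI ballI)
  fix x0 :: 'a and \<gamma> :: "real \<Rightarrow> 'a" and t assume "\<gamma> \<in> cadlag T" and t: "t \<in> {0..T}"
  then have p: "(x0, \<gamma>) \<in> inputs" by simp
  have eq: "drift solution_map (x0, \<gamma>) s = drift (traj sol) (x0, \<gamma>) s" if "s \<in> {0..t}" for s
  proof -
    have s: "s \<in> {0..T}" using that t by auto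
    \<comment> \<open>The two maps agree only on \<open>inputs\<close> and on \<open>[0, T]\<close>,
      which is enough since \<open>inputs\<close> is the whole space of
      \<open>\<nu>\<close>.\<close>
    have "distr \<nu> borel (\<lambda>p. solution_map p s) = distr \<nu> borel (\<lambda>p. traj sol p s)"
      by (intro distr_cong refl solution_map_eq_traj s) (simp add: space_nu)
    then show ?thesis using solution_map_eq_traj[OF p s] by (simp add: mv_drift_def)
  qed
  have "set_integrable lborel {0..t} (drift (traj sol) (x0, \<gamma>))"
    by (intro drift_integrable regular_sol p)
  then have "set_integrable lborel {0..t} (drift solution_map (x0, \<gamma>))"
    by (subst set_integrable_cong[OF refl refl eq]) auto
  moreover have "(LINT s:{0..t}|lborel. drift solution_map (x0, \<gamma>) s) = picard sol (x0, \<gamma>) t"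
    unfolding picard_def stop_id[OF t] using eq by (intro set_lebesgue_integral_cong) auto
  then have "solution_map (x0, \<gamma>) t
      = x0 + (LINT s:{0..t}|lborel. drift solution_map (x0, \<gamma>) s) + \<gamma> t"
    unfolding solution_map_eq_traj[OF p t] picard_sol[OF p t] traj_def stop_id[OF t] by simp
  ultimately show "set_integrable lborel {0..t} (drift solution_map (x0, \<gamma>)) \<and> solution_map (x0, \<gamma>) t
      = x0 + (LINT s:{0..t}|lborel. drift solution_map (x0, \<gamma>) s) + \<gamma> t" by blast
qed

text \<open>Arbitrary measurable solutions need not come from a regular \<open>v\<close>, so they
  are compared directly through the integral estimate. Iterating it bounds their difference by a
  null sequence, and extensionality in both arguments turns agreement on the domain into
  equality.\<close>

lemma solution_unique:
  assumes S: "S \<in> extensional inputs" "S' \<in> extensional inputs"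
    and meas: "S \<in> borel_of (path_input_topology T) \<rightarrow>\<^sub>M borel_of (skorokhod_topology T)"
      "S' \<in> borel_of (path_input_topology T) \<rightarrow>\<^sub>M borel_of (skorokhod_topology T)"
    and sol: "solves_mv_equation T b \<nu> S" "solves_mv_equation T b \<nu> S'"
  shows "S = S'"
proof -
  have solD: "set_integrable lborel {0..t} (drift Z p) \<and>
      Z p t = fst p + (LINT s:{0..t}|lborel. drift Z p s) + snd p t"
    if Z: "solves_mv_equation T b \<nu> Z" and p: "p \<in> inputs" and t: "t \<in> {0..T}" for Z p t
  proof -
    obtain x0 \<gamma> where "p = (x0, \<gamma>)" "\<gamma> \<in> cadlag T" using p by (cases p) auto
    then show ?thesis using Z t by (simp add: solves_mv_equation_def)
  qed
  note int = solD[OF sol(1), THEN conjunct1] solD[OF sol(2), THEN conjunct1]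
  note eq = solD[OF sol(1), THEN conjunct2] solD[OF sol(2), THEN conjunct2]
  have m: "(\<lambda>p. S p s) \<in> borel_measurable \<nu>" "(\<lambda>p. S' p s) \<in> borel_measurable \<nu>" if "s \<in> {0..T}" for s
    using measurable_eval[OF _ that] meas by auto
  have step: "norm (S p t - S' p t) \<le> C * (2 * K * t) ^ Suc k / fact (Suc k)"
    if "0 \<le> C" "\<And>p s. p \<in> inputs \<Longrightarrow> s \<in> {0..T} \<Longrightarrow> norm (S p s - S' p s) \<le> C * (2 * K * s) ^ k / fact k"
      "p \<in> inputs" "t \<in> {0..T}" for C k p t
    using drift_integral_diff_le[OF m that int[OF that(3,4)]] by (simp add: eq[OF that(3,4)])
  have bound: "norm (S p t - S' p t) \<le> (2 * K * T) * (2 * K * t) ^ n / fact n"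
    if "p \<in> inputs" "t \<in> {0..T}" for p t n
    using that
  proof (induction n arbitrary: p t)
    \<comment> \<open>No closeness of \<open>S\<close> and \<open>S'\<close> is known at the start;
      the bound \<open>K\<close> on each drift supplies the constant
      \<open>2 * K * T\<close>.\<close>
    case 0
    have c: "set_integrable lborel {0..t} (\<lambda>s. 2 * K)"
      by (simp add: set_integrable_def, intro integrable_real_indicator disjI2, auto simp: emeasure_lborel_Icc_eq)
    have "norm (S p t - S' p t) = norm (LINT s:{0..t}|lborel. drift S p s - drift S' p s)"
      using int[OF 0] by (simp add: eq[OF 0] set_integral_diff)
    also have "\<dots> \<le> (LINT s:{0..t}|lborel. norm (drift S p s - drift S' p s))"
      using int[OF 0] by (intro set_integral_norm_bound set_integral_diff)
    also have "\<dots> \<le> (LINT s:{0..t}|lborel. 2 * K)"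
    proof (rule set_integral_mono)
      fix s assume "s \<in> {0..t}"
      then have s: "s \<in> {0..T}" using 0 by auto
      have "norm (drift S p s - drift S' p s) \<le> K + K"
        by (rule order_trans[OF norm_triangle_ineq4]) (intro add_mono drift_le m s)
      then show "norm (drift S p s - drift S' p s) \<le> 2 * K" by simp
    qed (use int[OF 0] c in \<open>auto intro: set_integrable_norm\<close>)
    also have "\<dots> = 2 * K * t" using 0 by (simp add: set_lebesgue_integral_def)
    also have "\<dots> \<le> 2 * K * T" using 0 K_nonneg by (intro mult_left_mono) auto
    finally show ?case by simp
  next
    case (Suc n)
    show ?case using K_nonneg T by (intro step Suc) auto
  qed
  have "S p t = S' p t" if "p \<in> inputs" "t \<in> {0..T}" for p t
  proof -
    have "(\<lambda>n. inverse (fact n) * (2 * K * t) ^ n) \<longlonglongrightarrow> 0"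
      by (intro summable_LIMSEQ_zero summable_exp)
    then have "(\<lambda>n. (2 * K * T) * (inverse (fact n) * (2 * K * t) ^ n)) \<longlonglongrightarrow> (2 * K * T) * 0"
      by (intro tendsto_mult_left)
    then have "norm (S p t - S' p t) \<le> (2 * K * T) * 0"
      by (rule LIMSEQ_le_const) (use bound[OF that] in \<open>auto simp: field_simps\<close>)
    then show ?thesis by simp
  qed
  moreover have "S p \<in> extensional {0..T}" "S' p \<in> extensional {0..T}" if "p \<in> inputs" for p
    using measurable_space[OF meas(1), of p] measurable_space[OF meas(2), of p] that
    by (auto simp: cadlag_def)
  ultimately have "S p = S' p" if "p \<in> inputs" for p
    using that by (intro extensionalityI[of "S p" "{0..T}" "S' p"]) auto
  then show ?thesis using S by (intro extensionalityI[of S inputs S'])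
qed

end

theorem lemma19:
  fixes T K :: real
    and \<rho> :: "(real ^ 'n) measure \<Rightarrow> (real ^ 'n) measure \<Rightarrow> real"
    and b :: "(real ^ 'n::finite) \<Rightarrow> (real ^ 'n) measure \<Rightarrow> (real ^ 'n)"
    and \<nu> :: "((real ^ 'n) \<times> (real \<Rightarrow> (real ^ 'n))) measure"
  assumes "T > 0"
    and "Metric_space (borel_prob euclidean) \<rho>"
    and "Metric_space.mcomplete (borel_prob euclidean) \<rho>"
    and "metrizes_weak_convergence \<rho>"
    and "dominated_by_expectation \<rho>"
    and "case_prod b \<in> borel_of (prod_topology euclidean
           (Metric_space.mtopology (borel_prob euclidean) \<rho>)) \<rightarrow>\<^sub>M borel"
    and "\<And>x x' \<mu> \<mu>'. \<mu> \<in> borel_prob euclidean \<Longrightarrow> \<mu>' \<in> borel_prob euclidean \<Longrightarrow>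
           norm (b x \<mu> - b x' \<mu>') \<le> K * (norm (x - x') + \<rho> \<mu> \<mu>')"
    and "\<And>x \<mu>. \<mu> \<in> borel_prob euclidean \<Longrightarrow> norm (b x \<mu>) \<le> K"
    and "\<nu> \<in> borel_prob (path_input_topology T)"
  shows "\<exists>!S. S \<in> extensional (UNIV \<times> cadlag T) \<and>
           S \<in> borel_of (path_input_topology T) \<rightarrow>\<^sub>M borel_of (skorokhod_topology T) \<and>
           solves_mv_equation T b \<nu> S"
proof -
  interpret mckean_vlasov T K \<rho> b \<nu>
    by (rule mckean_vlasov.intro) (fact assms)+
  show ?thesis
  proof (rule ex1I[of _ solution_map])
    show "solution_map \<in> extensional (UNIV \<times> cadlag T) \<and>
        solution_map \<in> borel_of (path_input_topology T) \<rightarrow>\<^sub>M borel_of (skorokhod_topology T) \<and>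
        solves_mv_equation T b \<nu> solution_map"
      using continuous_map_measurable_borel_of[OF solution_map_continuous] solution_map_solves
      by (simp add: solution_map_def)
  qed (use solution_unique continuous_map_measurable_borel_of[OF solution_map_continuous]
      solution_map_solves in \<open>auto simp: solution_map_def\<close>)
qed

end
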